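(* Let $(Y_t)_{t=1}^\infty$ be a $[0,1]$-valued sequence of random variables such that $\mathsf{E}[Y_t\mid Y^{t-1}]\equiv\mu$ for every $t\ge1$ and some $\mu\in(0,1)$. Let $n\ge1$ be an integer and let $\boldsymbol\rho_0^{(1)},\boldsymbol\rho_0^{(2)}\in\mathbb{R}^{2n-1}$, $\eta_0^{(1)},\eta_0^{(2)}\in\mathbb{R}$ be hyperparameters. Let $(\breve\mu_t^{\mathrm{low}}(y^t;\delta),\breve\mu_t^{\mathrm{up}}(y^t;\delta))$ be the largest interval such that $$\hat\mu_t\in(\breve\mu_t^{\mathrm{low}}(y^t;\delta),\breve\mu_t^{\mathrm{up}}(y^t;\delta))\subseteq\Bigl\{m\in(0,1):\ \breve h_t^{(n)}(m;y^t;\boldsymbol\rho_0^{(1)},\eta_0^{(1)},\boldsymbol\rho_0^{(2)},\eta_0^{(2)})<\frac1\delta\Bigr\},$$ where $\hat\mu_t=\frac1t\sum_{i=1}^ty_i$ denotes the empirical mean. Then, for any $\delta\in(0,1]$, we have $$\mathsf{P}\bigl\{\exists t\ge1:\ \mu\notin(\breve\mu_t^{\mathrm{low}}(Y^t;\delta),\breve\mu_t^{\mathrm{up}}(Y^t;\delta))\bigr\}\le\delta.$$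
   Context: For a number $x$, $\bar x=1-x$; for $y^t=(y_1,\dots,y_t)\in[0,1]^t$, $\bar y^t=(1-y_i)_{i=1}^t$; $Y^t=(Y_1,\dots,Y_t)$. For parameters $\boldsymbol\rho\in\mathbb{R}^{2n-1}$ and a scalar $\eta$, define for $x\in(0,1)$ the unnormalized density $\phi_n(x;\boldsymbol\rho,\eta)=\exp\bigl(\sum_{k=1}^{2n-1}\frac{(1-x)^k}{k}\rho_k+\eta\log x\bigr)$, with normalization constant $Z_n(\boldsymbol\rho,\eta)=\int_0^1\phi_n(x;\boldsymbol\rho,\eta)\,dx$. For $y^t\in[0,1]^t$ and $m\in(0,1)$, let $(\boldsymbol\rho_n(y^t;m))_k=\sum_{i=1}^t\{(1-\frac{y_i}{m})^{2n}-(1-\frac{y_i}{m})^k\}$ for $k=1,\dots,2n-1$, and $\eta_n(y^t;m)=\sum_{i=1}^t(1-\frac{y_i}{m})^{2n}$. Finally, $$\breve h_t^{(n)}(m;y^t;\boldsymbol\rho_0^{(1)},\eta_0^{(1)},\boldsymbol\rho_0^{(2)},\eta_0^{(2)})=\frac{\bar m\,Z_n\bigl(\boldsymbol\rho_n(y^t;m)+\boldsymbol\rho_0^{(1)},\eta_n(y^t;m)+\eta_0^{(1)}\bigr)+m\,Z_n\bigl(\boldsymbol\rho_n(\bar y^t;\bar m)+\boldsymbol\rho_0^{(2)},\eta_n(\bar y^t;\bar m)+\eta_0^{(2)}\bigr)}{\bar m\,Z_n(\boldsymbol\rho_0^{(1)},\eta_0^{(1)})+m\,Z_n(\boldsymb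ol\rho_0^{(2)},\eta_0^{(2)})}.$$
   Formalization: When the empirical mean is 0 or 1, no interval inside (0,1) contains it; the interval is then required to start at 0, respectively end at 1. If a prior normalization constant is infinite, the ratio h is taken to be 0; if no such interval exists, it is empty. *)

theory Defs
  imports "HOL-Probability.Probability"
begin

text \<open>
  A vector in \<open>\<real>\<close> to the power \<open>2n-1\<close> is a function \<open>nat \<Rightarrow> real\<close> of which only the values
  at \<open>1, \<dots>, 2n-1\<close> are used; likewise a sample \<open>y\<^sub>1, \<dots>, y\<^sub>t\<close> is a function of which only the
  values at \<open>1, \<dots>, t\<close> are used.
\<close>

definition phi :: "nat \<Rightarrow> (nat \<Rightarrow> real) \<Rightarrow> real \<Rightarrow> real \<Rightarrow> real" where
  "phi n \<rho> \<eta> x = exp ((\<Sum>k = 1..2*n-1. (1 - x) ^ k / real k * \<rho> k) + \<eta> * ln x)"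

text \<open>
  The normalization constant is taken in \<open>ennreal\<close>, since it is infinite when \<open>\<eta> \<le> -1\<close>.
\<close>

definition Zn :: "nat \<Rightarrow> (nat \<Rightarrow> real) \<Rightarrow> real \<Rightarrow> ennreal" where
  "Zn n \<rho> \<eta> = (\<integral>\<^sup>+x\<in>{0<..<1}. ennreal (phi n \<rho> \<eta> x) \<partial>lborel)"

definition rho_n :: "nat \<Rightarrow> nat \<Rightarrow> (nat \<Rightarrow> real) \<Rightarrow> real \<Rightarrow> nat \<Rightarrow> real" where
  "rho_n n t y m k = (\<Sum>i = 1..t. (1 - y i / m) ^ (2*n) - (1 - y i / m) ^ k)"

definition eta_n :: "nat \<Rightarrow> nat \<Rightarrow> (nat \<Rightarrow> real) \<Rightarrow> real \<Rightarrow> real" where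
  "eta_n n t y m = (\<Sum>i = 1..t. (1 - y i / m) ^ (2*n))"

text \<open>
  For an improper prior (\<open>\<eta>1 \<le> -1\<close> or \<open>\<eta>2 \<le> -1\<close>) and \<open>0 < m < 1\<close> the denominator below is
  infinite and the quotient is \<open>0\<close>, by the conventions for division in \<open>ennreal\<close>.
\<close>

definition h_breve :: "nat \<Rightarrow> nat \<Rightarrow> real \<Rightarrow> (nat \<Rightarrow> real) \<Rightarrow>
    (nat \<Rightarrow> real) \<Rightarrow> real \<Rightarrow> (nat \<Rightarrow> real) \<Rightarrow> real \<Rightarrow> ennreal" where
  "h_breve n t m y \<rho>1 \<eta>1 \<rho>2 \<eta>2 =
     (ennreal (1 - m) * Zn n (\<lambda>k. rho_n n t y m k + \<rho>1 k) (eta_n n t y m + \<eta>1)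
      + ennreal m * Zn n (\<lambda>k. rho_n n t (\<lambda>i. 1 - y i) (1 - m) k + \<rho>2 k)
                         (eta_n n t (\<lambda>i. 1 - y i) (1 - m) + \<eta>2))
     / (ennreal (1 - m) * Zn n \<rho>1 \<eta>1 + ennreal m * Zn n \<rho>2 \<eta>2)"

definition sublevel_set :: "nat \<Rightarrow> nat \<Rightarrow> (nat \<Rightarrow> real) \<Rightarrow>
    (nat \<Rightarrow> real) \<Rightarrow> real \<Rightarrow> (nat \<Rightarrow> real) \<Rightarrow> real \<Rightarrow> real \<Rightarrow> real set" where
  "sublevel_set n t y \<rho>1 \<eta>1 \<rho>2 \<eta>2 \<delta> =
     {m \<in> {0<..<1}. h_breve n t m y \<rho>1 \<eta>1 \<rho>2 \<eta>2 < ennreal (1 / \<delta>)}"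

definition emp_mean :: "nat \<Rightarrow> (nat \<Rightarrow> real) \<Rightarrow> real" where
  "emp_mean t y = (\<Sum>i = 1..t. y i) / real t"

text \<open>
  When the empirical mean \<open>c\<close> is \<open>0\<close> or \<open>1\<close>, no open interval inside \<open>(0,1)\<close> contains it.
  In that case the interval is required to start at \<open>0\<close>, respectively to end at \<open>1\<close>; that is,
  it contains \<open>c\<close> once that end point is adjoined.
\<close>

definition interval_around :: "real \<Rightarrow> real set \<Rightarrow> real \<times> real \<Rightarrow> bool" where
  "interval_around c S = (\<lambda>(l, u). l < u \<and> {l<..<u} \<subseteq> S \<and>
     (c \<in> {l<..<u} \<or> (c = 0 \<and> l = 0) \<or> (c = 1 \<and> u = 1)))"

definition largest_interval_around :: "real \<Rightarrow> real set \<Rightarrow> real \<times> real \<Rightarrow> bool" where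
  "largest_interval_around c S p \<longleftrightarrow> interval_around c S p \<and>
     (\<forall>q. interval_around c S q \<longrightarrow> {fst q<..<snd q} \<subseteq> {fst p<..<snd p})"

text \<open>If there is no such interval at all, the bounds are \<open>(c, c)\<close>, an empty open interval.\<close>

definition interval_bounds :: "real \<Rightarrow> real set \<Rightarrow> real \<times> real" where
  "interval_bounds c S =
     (if \<exists>p. largest_interval_around c S p then THE p. largest_interval_around c S p else (c, c))"

definition mu_low :: "nat \<Rightarrow> nat \<Rightarrow> (nat \<Rightarrow> real) \<Rightarrow>
    (nat \<Rightarrow> real) \<Rightarrow> real \<Rightarrow> (nat \<Rightarrow> real) \<Rightarrow> real \<Rightarrow> real \<Rightarrow> real" where
  "mu_low n t y \<rho>1 \<eta>1 \<rho>2 \<eta>2 \<delta> =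
     fst (interval_bounds (emp_mean t y) (sublevel_set n t y \<rho>1 \<eta>1 \<rho>2 \<eta>2 \<delta>))"

definition mu_up :: "nat \<Rightarrow> nat \<Rightarrow> (nat \<Rightarrow> real) \<Rightarrow>
    (nat \<Rightarrow> real) \<Rightarrow> real \<Rightarrow> (nat \<Rightarrow> real) \<Rightarrow> real \<Rightarrow> real \<Rightarrow> real" where
  "mu_up n t y \<rho>1 \<eta>1 \<rho>2 \<eta>2 \<delta> =
     snd (interval_bounds (emp_mean t y) (sublevel_set n t y \<rho>1 \<eta>1 \<rho>2 \<eta>2 \<delta>))"

text \<open>The sigma-algebra generated by the random vector \<open>(Y\<^sub>1, \<dots>, Y\<^sub>t\<^sub>-\<^sub>1)\<close>; trivial for \<open>t = 1\<close>.\<close>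

definition past :: "'a measure \<Rightarrow> (nat \<Rightarrow> 'a \<Rightarrow> real) \<Rightarrow> nat \<Rightarrow> 'a measure" where
  "past M Y t =
     vimage_algebra (space M) (\<lambda>\<omega>. \<lambda>i\<in>{1..<t}. Y i \<omega>) (Pi\<^sub>M {1..<t} (\<lambda>_. borel))"

end

theory Submission
  imports Defs
begin

text \<open>
  For \<open>z \<le> 1\<close> and \<open>0 < x < 1\<close>, truncating the logarithmic series of \<open>1 - (1 - x) z\<close> at order \<open>2n\<close>
  and replacing the tail by \<open>z^(2n)\<close> times the tail at \<open>z = 1\<close> gives a lower bound for the logarithm.
  Hence the numerator of \<open>h_breve\<close> at \<open>m\<close> is at most \<open>(1 - m) A(m) + m B(m)\<close>, where \<open>A(m)\<close> and \<open>B(m)\<close>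
  average the products \<open>\<Prod>(x + (1 - x) y\<^sub>i / m)\<close> and \<open>\<Prod>(x + (1 - x) (1 - y\<^sub>i) / (1 - m))\<close>
  over \<open>x\<close>. At \<open>m = \<mu>\<close> these are martingales, so Ville's inequality bounds the probability that
  the mixture ever exceeds \<open>1/\<delta>\<close> times its initial value.

  It remains to pass from sublevel sets to intervals. The mixture is convex in \<open>m\<close>, and at the
  empirical mean it is at most its initial value. So if it is below the threshold at \<open>\<mu>\<close>, it is
  below the threshold on the whole segment from \<open>\<mu>\<close> to the empirical mean, and so is \<open>h_breve\<close>.
\<close>

section \<open>Truncated logarithmic series\<close>

text \<open>The difference of the two sides vanishes at \<open>v = 0\<close>, and its derivative in
  \<open>v\<close> is \<open>z ^ (2*n) * v ^ (2*n-1)\<close> times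
  \<open>1 / (1 - v) - 1 / (1 - v * z)\<close>. This is nonnegative: the exponent of
  \<open>z\<close> is even, and \<open>v * z \<le> v\<close>, also for negative
  \<open>z\<close>.\<close>

lemma ln_one_minus_mult_ge:
  fixes v z :: real
  assumes "0 \<le> v" "v < 1" "z \<le> 1" "n \<ge> 1"
  shows "(\<Sum>k = 1..2*n-1. v ^ k / real k * (z ^ (2*n) - z ^ k)) + z ^ (2*n) * ln (1 - v)
    \<le> ln (1 - v * z)"
proof -
  define E where "E = (\<lambda>v. ln (1 - v * z)
    - (\<Sum>k = 1..2*n-1. v ^ k / real k * (z ^ (2*n) - z ^ k)) - z ^ (2*n) * ln (1 - v))"
  define E' where "E' = (\<lambda>v. z ^ (2*n) * v ^ (2*n-1) * (1 / (1 - v) - 1 / (1 - v * z)))"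
  have lt1: "u * z < 1" if "0 \<le> u" "u < 1" for u
    using that assms mult_left_mono[of z 1 u] by linarith
  have deriv: "(E has_real_derivative E' u) (at u)" if u: "0 \<le> u" "u < 1" for u
  proof -
    have s: "((\<lambda>v. \<Sum>k = 1..2*n-1. v ^ k / real k * (z ^ (2*n) - z ^ k)) has_real_derivative
       (\<Sum>k = 1..2*n-1. u ^ (k - 1) * (z ^ (2*n) - z ^ k))) (at u)"
      by (rule DERIV_sum) (auto intro!: derivative_eq_intros)
    have l1: "((\<lambda>v. ln (1 - v * z)) has_real_derivative - z / (1 - u * z)) (at u)"
      using lt1[OF u] by (auto intro!: derivative_eq_intros)
    have l2: "((\<lambda>v. z ^ (2*n) * ln (1 - v)) has_real_derivative - (z ^ (2*n) / (1 - u))) (at u)"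
      using u by (auto intro!: derivative_eq_intros)
    have "(E has_real_derivative (- z / (1 - u * z)
       - (\<Sum>k = 1..2*n-1. u ^ (k - 1) * (z ^ (2*n) - z ^ k)) + z ^ (2*n) / (1 - u))) (at u)"
      unfolding E_def using DERIV_diff[OF DERIV_diff[OF l1 s] l2] by simp
    \<comment> \<open>Both parts of the sum are geometric series; their leading terms cancel the
      derivatives of the two logarithms and leave only the tails.\<close>
    moreover have "- z / (1 - u * z) - (\<Sum>k = 1..2*n-1. u ^ (k - 1) * (z ^ (2*n) - z ^ k))
        + z ^ (2*n) / (1 - u) = E' u"
    proof -
      define N where "N = 2 * n - 1"
      have N: "2 * n = Suc N" using assms(4) by (simp add: N_def)
      have geo: "(\<Sum>k = 1..N. w ^ (k - 1)) = (1 - w ^ N) / (1 - w)" if "w \<noteq> 1" for w :: real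
      proof -
        have "(\<Sum>k = 1..N. w ^ (k - 1)) = (\<Sum>k<N. w ^ k)"
          by (rule sum.reindex_bij_witness[of _ Suc "\<lambda>k. k - 1"]) auto
        thus ?thesis using that by (simp add: sum_gp_strict)
      qed
      have "(\<Sum>k = 1..N. u ^ (k - 1) * (z ^ (2*n) - z ^ k))
        = (\<Sum>k = 1..N. z ^ (2*n) * u ^ (k - 1) - z * (u * z) ^ (k - 1))"
      proof (rule sum.cong[OF refl])
        fix k assume "k \<in> {1..N}"
        then have "z ^ k = z * z ^ (k - 1)" by (cases k) auto
        thus "u ^ (k - 1) * (z ^ (2*n) - z ^ k) = z ^ (2*n) * u ^ (k - 1) - z * (u * z) ^ (k - 1)"
          by (simp add: power_mult_distrib algebra_simps)
      qed
      also have "\<dots> = z ^ (2*n) * ((1 - u ^ N) / (1 - u)) - z * ((1 - (u * z) ^ N) / (1 - u * z))"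
        using geo[of u] geo[of "u * z"] u lt1[OF u]
        by (simp add: sum_subtractf sum_distrib_left[symmetric])
      finally have *: "(\<Sum>k = 1..N. u ^ (k - 1) * (z ^ (2*n) - z ^ k)) = \<dots>" .
      have "- z / (1 - u * z) - (z ^ (2*n) * ((1 - u ^ N) / (1 - u)) - z * ((1 - (u * z) ^ N) / (1 - u * z)))
        + z ^ (2*n) / (1 - u) = z ^ (2*n) * u ^ N * (1 / (1 - u)) - z * (u * z) ^ N * (1 / (1 - u * z))"
        using u lt1[OF u] by (simp add: diff_divide_distrib algebra_simps)
      \<comment> \<open>Truncating at \<open>N = 2 * n - 1\<close> gives this tail the same factor
        \<open>z ^ (2*n)\<close> as the other one.\<close>
      also have "z * (u * z) ^ N = z ^ (2*n) * u ^ N"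
        unfolding N by (simp add: power_mult_distrib)
      finally show ?thesis using * unfolding E'_def N_def by (simp add: algebra_simps)
    qed
    ultimately show ?thesis by simp
  qed
  have nonneg: "E' u \<ge> 0" if u: "0 \<le> u" "u < 1" for u
  proof -
    have "u * z \<le> u" using u assms by (simp add: mult_left_le)
    hence "1 / (1 - u * z) \<le> 1 / (1 - u)" using u lt1[OF u] by (intro divide_left_mono) auto
    moreover have "z ^ (2*n) \<ge> 0" by simp
    ultimately show ?thesis unfolding E'_def using u by (intro mult_nonneg_nonneg) auto
  qed
  have "E 0 \<le> E v"
    using assms by (intro DERIV_nonneg_imp_nondecreasing[of 0 v E])
      (auto intro!: exI[of _ "E' _"] deriv nonneg)
  moreover have "E 0 = 0" unfolding E_def by (auto intro!: sum.neutral simp: zero_power)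
  ultimately show ?thesis unfolding E_def by simp
qed

section \<open>Betting wealth and its mixtures\<close>

text \<open>The capital after \<open>t\<close> rounds when in each round a fraction
  \<open>1 - x\<close> is staked on a gamble returning \<open>y i / m\<close> per unit and the rest
  is held back. The gamble is fair when \<open>y i\<close> has conditional mean
  \<open>m\<close>.\<close>

definition wealth :: "nat \<Rightarrow> real \<Rightarrow> (nat \<Rightarrow> real) \<Rightarrow> real \<Rightarrow> real" where
  "wealth t x y m = (\<Prod>i = 1..t. x + (1 - x) * (y i / m))"

lemma wealth_nonneg:
  assumes "0 \<le> x" "x \<le> 1" "0 \<le> m" "\<And>i. i \<in> {1..t} \<Longrightarrow> 0 \<le> y i"
  shows "0 \<le> wealth t x y m"
  using assms unfolding wealth_def by (intro prod_nonneg ballI add_nonneg_nonneg mult_nonneg_nonneg) auto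

lemma phi_pos: "0 < phi n \<rho> \<eta> x"
  by (simp add: phi_def)

text \<open>The densities form an exponential family, so adding parameters multiplies densities.
  This factorization serves both the comparison with \<open>wealth\<close> and the domination bound
  \<open>phi_add_le\<close>.\<close>

lemma phi_add:
  "phi n (\<lambda>k. \<rho>' k + \<rho> k) (\<eta>' + \<eta>) x
    = exp ((\<Sum>k = 1..2*n-1. (1 - x) ^ k / real k * \<rho>' k) + \<eta>' * ln x) * phi n \<rho> \<eta> x"
  unfolding phi_def by (simp add: exp_add[symmetric] distrib_left distrib_right sum.distrib add_ac)

text \<open>\<open>ln_one_minus_mult_ge\<close> is applied with \<open>v = 1 - x\<close> and
  \<open>z = 1 - y i / m\<close>, so that \<open>1 - v * z\<close> is the \<open>i\<close>-th factor
  of \<open>wealth\<close>. Summed over \<open>i\<close>, the coefficients of its left side are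
  exactly \<open>rho_n\<close> and \<open>eta_n\<close>.\<close>

lemma phi_le_wealth_mult_phi:
  assumes x: "0 < x" "x < 1" and m: "0 < m" and n: "n \<ge> 1" and y: "\<And>i. i \<in> {1..t} \<Longrightarrow> 0 \<le> y i"
  shows "phi n (\<lambda>k. rho_n n t y m k + \<rho> k) (eta_n n t y m + \<eta>) x \<le> wealth t x y m * phi n \<rho> \<eta> x"
proof -
  define z where "z = (\<lambda>i. 1 - y i / m)"
  define T where "T = (\<lambda>i. (\<Sum>k = 1..2*n-1. (1 - x) ^ k / real k * (z i ^ (2*n) - z i ^ k)) + z i ^ (2*n) * ln x)"
  have T: "T i \<le> ln (x + (1 - x) * (y i / m))" if "i \<in> {1..t}" for i
    using ln_one_minus_mult_ge[of "1 - x" "z i" n] x m n y[OF that]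
    by (simp add: T_def z_def algebra_simps)
  have pos: "x + (1 - x) * (y i / m) > 0" if "i \<in> {1..t}" for i
    using x m y[OF that] by (intro add_pos_nonneg mult_nonneg_nonneg) auto
  have "(\<Sum>i = 1..t. T i) = (\<Sum>k = 1..2*n-1. (1 - x) ^ k / real k * rho_n n t y m k) + eta_n n t y m * ln x"
    unfolding T_def rho_n_def eta_n_def z_def
    by (simp add: sum.distrib sum_distrib_left sum_distrib_right, subst sum.swap, rule refl)
  hence "phi n (\<lambda>k. rho_n n t y m k + \<rho> k) (eta_n n t y m + \<eta>) x = exp (\<Sum>i = 1..t. T i) * phi n \<rho> \<eta> x"
    unfolding phi_add by simp
  also have "exp (\<Sum>i = 1..t. T i) \<le> exp (\<Sum>i = 1..t. ln (x + (1 - x) * (y i / m)))"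
    unfolding exp_le_cancel_iff by (rule sum_mono) (rule T)
  also have "\<dots> = wealth t x y m"
    unfolding wealth_def exp_sum[OF finite_atLeastAtMost] using pos by (intro prod.cong refl exp_ln) auto
  finally show ?thesis using phi_pos[of n \<rho> \<eta> x] by (simp add: mult_right_mono)
qed

text \<open>The prior density is left unnormalized, so the initial value is
  \<open>Zn n \<rho> \<eta>\<close>, possibly infinite, instead of 1.\<close>

definition mixture :: "nat \<Rightarrow> nat \<Rightarrow> (nat \<Rightarrow> real) \<Rightarrow> real \<Rightarrow> (nat \<Rightarrow> real) \<Rightarrow> real \<Rightarrow> ennreal" where
  "mixture n t \<rho> \<eta> y m = (\<integral>\<^sup>+x\<in>{0<..<1}. ennreal (wealth t x y m * phi n \<rho> \<eta> x) \<partial>lborel)"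

lemma Zn_le_mixture:
  assumes "0 < m" "n \<ge> 1" "\<And>i. i \<in> {1..t} \<Longrightarrow> 0 \<le> y i"
  shows "Zn n (\<lambda>k. rho_n n t y m k + \<rho> k) (eta_n n t y m + \<eta>) \<le> mixture n t \<rho> \<eta> y m"
  unfolding Zn_def mixture_def
  using phi_le_wealth_mult_phi[OF _ _ assms]
  by (intro nn_integral_mono) (auto simp: indicator_def intro!: ennreal_leI)

lemma measurable_phi [measurable]: "phi n \<rho> \<eta> \<in> borel_measurable borel"
  unfolding phi_def by measurable

lemma Zn_pos: "Zn n \<rho> \<eta> > 0"
proof (rule ccontr)
  assume "\<not> ?thesis"
  hence "(\<integral>\<^sup>+x. ennreal (phi n \<rho> \<eta> x) * indicator {0<..<1} x \<partial>lborel) = 0"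
    by (simp add: Zn_def)
  hence "AE x in lborel. ennreal (phi n \<rho> \<eta> x) * indicator {0<..<1} x = 0"
    by (subst (asm) nn_integral_0_iff_AE) auto
  hence "AE x in lborel. x \<notin> {0<..<1::real}"
    by eventually_elim (auto simp: ennreal_eq_0_iff phi_def split: split_indicator_asm)
  hence "{0<..<1::real} \<in> null_sets lborel"
    by (subst (asm) AE_iff_null_sets[symmetric]) auto
  thus False by (simp add: null_sets_def)
qed

section \<open>Convexity of the mixture wealth\<close>

text \<open>Products of convex functions need not be convex, but they are if the factors are also
  nonnegative and all increasing. The induction therefore carries the three properties
  together.\<close>

lemma convex_mono_on_prod:
  fixes D :: "real set" and f :: "'i \<Rightarrow> real \<Rightarrow> real"
  assumes "finite I" "convex D"
    and "\<And>i. i \<in> I \<Longrightarrow> convex_on D (f i) \<and> mono_on D (f i) \<and> f i \<in> D \<rightarrow> {0..}"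
  shows "convex_on D (\<lambda>m. \<Prod>i\<in>I. f i m) \<and> mono_on D (\<lambda>m. \<Prod>i\<in>I. f i m)
    \<and> (\<lambda>m. \<Prod>i\<in>I. f i m) \<in> D \<rightarrow> {0..}"
  using assms(1,3)
proof (induction I rule: finite_induct)
  case empty
  thus ?case using assms(2) by (auto simp: convex_on_const monotone_on_def)
next
  case (insert i I)
  hence IH: "convex_on D (\<lambda>m. \<Prod>i\<in>I. f i m)" "mono_on D (\<lambda>m. \<Prod>i\<in>I. f i m)"
    "(\<lambda>m. \<Prod>i\<in>I. f i m) \<in> D \<rightarrow> {0..}" and i: "convex_on D (f i)" "mono_on D (f i)" "f i \<in> D \<rightarrow> {0..}"
    by auto
  have "mono_on D (\<lambda>m. f i m * (\<Prod>i\<in>I. f i m))"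
    using IH(2,3) i(2,3) unfolding monotone_on_def Pi_def by (auto intro!: mult_mono)
  thus ?case using convex_on_mul[OF i(1) IH(1) i(2) IH(2) i(3) IH(3)] IH(3) i(3) insert(1,2)
    by (auto simp: Pi_def)
qed

text \<open>
  The point \<open>0\<close> may be added to the domain when the whole sample is \<open>0\<close>,
  since then \<open>y i / m = 0\<close> holds for \<open>m = 0\<close> as well.
\<close>

definition wealth_dom :: "nat \<Rightarrow> (nat \<Rightarrow> real) \<Rightarrow> real set" where
  "wealth_dom t y = {m \<in> {0..1}. m = 0 \<longrightarrow> (\<forall>i\<in>{1..t}. y i = 0)}"

lemma convex_wealth_dom: "convex (wealth_dom t y)"
proof (cases "\<forall>i\<in>{1..t}. y i = 0")
  case True
  hence "wealth_dom t y = {0..1}" by (auto simp: wealth_dom_def)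
  thus ?thesis by simp
next
  case False
  hence "wealth_dom t y = {0<..1}" by (auto simp: wealth_dom_def)
  thus ?thesis by simp
qed

text \<open>Reflecting \<open>m\<close> to \<open>1 - m\<close> makes every factor increasing.\<close>

lemma convex_on_wealth:
  assumes x: "0 < x" "x < 1" and y: "\<And>i. i \<in> {1..t} \<Longrightarrow> 0 \<le> y i"
  shows "convex_on (wealth_dom t y) (\<lambda>m. (1 - m) * wealth t x y m)"
proof -
  define D where "D = {m. 1 - m \<in> wealth_dom t y}"
  have D: "D = (\<lambda>m. 1 - m) ` wealth_dom t y"
    by (force simp: D_def)
  have "convex D"
    using convex_translation[OF convex_negations[OF convex_wealth_dom], of 1 t y]
    by (simp add: D image_image)
  have "convex_on D (\<lambda>m. x + (1 - x) * (y i / (1 - m)))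
      \<and> mono_on D (\<lambda>m. x + (1 - x) * (y i / (1 - m)))
      \<and> (\<lambda>m. x + (1 - x) * (y i / (1 - m))) \<in> D \<rightarrow> {0..}" if i: "i \<in> {1..t}" for i
  \<comment> \<open>A zero observation gives the constant factor \<open>x\<close>, even at the
    reflected point \<open>m = 1\<close>, where division by zero yields \<open>0\<close>. A nonzero
    one excludes that point from \<open>D\<close>, so \<open>inverse (1 - m)\<close> has no pole
    there.\<close>
  proof (cases "y i = 0")
    case True
    thus ?thesis using \<open>convex D\<close> x by (auto simp: convex_on_const monotone_on_def)
  next
    case False
    hence D1: "D \<subseteq> {0..<1}" using i by (auto simp: D_def wealth_dom_def)
    have "convex_on D (\<lambda>m. inverse (1 - m))"
    proof (rule convex_onI)
      fix s a b :: real assume s: "0 < s" "s < 1" "a \<in> D" "b \<in> D"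
      have "inverse ((1 - s) *\<^sub>R (1 - a) + s *\<^sub>R (1 - b)) \<le> (1 - s) * inverse (1 - a) + s * inverse (1 - b)"
        using s D1 by (intro convex_onD[OF convex_on_inverse[of "{0<..}"]]) auto
      thus "inverse (1 - ((1 - s) *\<^sub>R a + s *\<^sub>R b)) \<le> (1 - s) * inverse (1 - a) + s * inverse (1 - b)"
        by (simp add: algebra_simps)
    qed fact
    hence "convex_on D (\<lambda>m. x + (1 - x) * y i * inverse (1 - m))"
      using x y[OF i] \<open>convex D\<close> by (intro convex_on_add convex_on_cmul) (auto simp: convex_on_const)
    moreover have "mono_on D (\<lambda>m. x + (1 - x) * (y i / (1 - m)))"
      using x y[OF i] D1 unfolding monotone_on_def
      by (auto intro!: mult_left_mono divide_left_mono)
    moreover have "(\<lambda>m. x + (1 - x) * (y i / (1 - m))) \<in> D \<rightarrow> {0..}"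
      using x y[OF i] D1 by (auto intro!: add_nonneg_nonneg mult_nonneg_nonneg divide_nonneg_nonneg)
    ultimately show ?thesis by (simp add: divide_inverse mult.assoc)
  qed
  from convex_mono_on_prod[of "{1..t}" D "\<lambda>i m. x + (1 - x) * (y i / (1 - m))",
      OF finite_atLeastAtMost \<open>convex D\<close> this]
  have P: "convex_on D (\<lambda>m. wealth t x y (1 - m))" "mono_on D (\<lambda>m. wealth t x y (1 - m))"
    "(\<lambda>m. wealth t x y (1 - m)) \<in> D \<rightarrow> {0..}"
    unfolding wealth_def by blast+
  \<comment> \<open>In the reflected variable the prefactor \<open>1 - m\<close> becomes
    \<open>m\<close>, which is itself nonnegative, increasing and convex, so it joins the
    product.\<close>
  have c: "convex_on D (\<lambda>m. m * wealth t x y (1 - m))"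
    using \<open>convex D\<close> by (intro convex_on_mul P) (auto simp: convex_on_ident monotone_on_def D_def wealth_dom_def)
  show ?thesis
  proof (rule convex_onI)
    fix s a b :: real assume s: "0 < s" "s < 1" "a \<in> wealth_dom t y" "b \<in> wealth_dom t y"
    have e: "(1 - s) *\<^sub>R (1 - a) + s *\<^sub>R (1 - b) = 1 - ((1 - s) *\<^sub>R a + s *\<^sub>R b)"
      by (simp add: algebra_simps)
    have "1 - a \<in> D" "1 - b \<in> D" using s by (auto simp: D_def)
    thus "(1 - ((1 - s) *\<^sub>R a + s *\<^sub>R b)) * wealth t x y ((1 - s) *\<^sub>R a + s *\<^sub>R b)
        \<le> (1 - s) * ((1 - a) * wealth t x y a) + s * ((1 - b) * wealth t x y b)"
      using convex_onD[OF c, of s "1 - a" "1 - b"] s unfolding e by simp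
  qed (rule convex_wealth_dom)
qed

lemma measurable_wealth [measurable]: "(\<lambda>x. wealth t x y m) \<in> borel_measurable borel"
  unfolding wealth_def by measurable

text \<open>Pointwise in \<open>x\<close> this is \<open>convex_on_wealth\<close> times a positive
  density, and integration preserves the inequality. It is written out for two points in
  \<open>ennreal\<close> because the integrals may be infinite.\<close>

lemma mixture_convex:
  assumes "0 \<le> s" "s \<le> 1" "a \<in> wealth_dom t y" "b \<in> wealth_dom t y"
    and y: "\<And>i. i \<in> {1..t} \<Longrightarrow> 0 \<le> y i"
  defines "m \<equiv> (1 - s) * a + s * b"
  shows "ennreal (1 - m) * mixture n t \<rho> \<eta> y m
    \<le> ennreal (1 - s) * (ennreal (1 - a) * mixture n t \<rho> \<eta> y a)
      + ennreal s * (ennreal (1 - b) * mixture n t \<rho> \<eta> y b)"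
proof -
  have ab: "0 \<le> a" "a \<le> 1" "0 \<le> b" "b \<le> 1" using assms by (auto simp: wealth_dom_def)
  have "m \<in> wealth_dom t y"
    using convexD[OF convex_wealth_dom assms(3,4), of "1 - s" s] assms(1,2) by (simp add: m_def)
  hence m: "0 \<le> m" "m \<le> 1" by (simp_all add: wealth_dom_def)
  let ?I = "indicator {0<..<1} :: real \<Rightarrow> ennreal" and ?p = "phi n \<rho> \<eta>"
  have "ennreal (1 - m) * mixture n t \<rho> \<eta> y m
      = (\<integral>\<^sup>+x. ennreal (1 - m) * (ennreal (wealth t x y m * ?p x) * ?I x) \<partial>lborel)"
    unfolding mixture_def by (rule nn_integral_cmult[symmetric]) measurable
  also have "\<dots> \<le> (\<integral>\<^sup>+x. ennreal (1 - s) * (ennreal (1 - a) * (ennreal (wealth t x y a * ?p x) * ?I x))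
      + ennreal s * (ennreal (1 - b) * (ennreal (wealth t x y b * ?p x) * ?I x)) \<partial>lborel)"
  proof (rule nn_integral_mono)
    fix x :: real
    show "ennreal (1 - m) * (ennreal (wealth t x y m * ?p x) * ?I x)
      \<le> ennreal (1 - s) * (ennreal (1 - a) * (ennreal (wealth t x y a * ?p x) * ?I x))
      + ennreal s * (ennreal (1 - b) * (ennreal (wealth t x y b * ?p x) * ?I x))"
    proof (cases "x \<in> {0<..<1}")
      case True
      hence w: "0 \<le> wealth t x y u" if "0 \<le> u" for u
        using that y by (intro wealth_nonneg) auto
      have "(1 - m) * wealth t x y m
          \<le> (1 - s) * ((1 - a) * wealth t x y a) + s * ((1 - b) * wealth t x y b)"
        using convex_onD[OF convex_on_wealth[of x t y], of s a b] True assms by simp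
      hence "(1 - m) * wealth t x y m * ?p x
          \<le> ((1 - s) * ((1 - a) * wealth t x y a) + s * ((1 - b) * wealth t x y b)) * ?p x"
        using phi_pos[of n \<rho> \<eta> x] by (intro mult_right_mono) auto
      hence "(1 - m) * (wealth t x y m * ?p x)
          \<le> (1 - s) * ((1 - a) * (wealth t x y a * ?p x)) + s * ((1 - b) * (wealth t x y b * ?p x))"
        by (simp add: algebra_simps)
      thus ?thesis
        using True w m ab assms(1,2) phi_pos[of n \<rho> \<eta> x]
        by (simp flip: ennreal_mult ennreal_plus add: less_imp_le ennreal_leI)
    qed simp
  qed
  also have "\<dots> = ennreal (1 - s) * (ennreal (1 - a) * mixture n t \<rho> \<eta> y a)
      + ennreal s * (ennreal (1 - b) * mixture n t \<rho> \<eta> y b)"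
    unfolding mixture_def by (simp add: nn_integral_add nn_integral_cmult)
  finally show ?thesis .
qed

text \<open>By \<open>1 + u \<le> exp u\<close>, the product is at most the exponential of a
  nonnegative multiple of the sum of \<open>y i / c - 1\<close>, where \<open>c\<close> is the
  empirical mean, and this sum is at most \<open>0\<close>: against the empirical mean no constant
  stake could have made a gain.\<close>

lemma wealth_emp_mean_le_1:
  assumes "0 \<le> x" "x \<le> 1" "t \<ge> 1" and y: "\<And>i. i \<in> {1..t} \<Longrightarrow> 0 \<le> y i"
  shows "wealth t x y (emp_mean t y) \<le> 1"
proof -
  define c where "c = emp_mean t y"
  have c: "c \<ge> 0" unfolding c_def emp_mean_def using y by (intro divide_nonneg_nonneg sum_nonneg) auto
  \<comment> \<open>Equality holds when \<open>c \<noteq> 0\<close>; for \<open>c = 0\<close> every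
    quotient is \<open>0\<close> by convention, whence only an inequality.\<close>
  have "(\<Sum>i = 1..t. y i / c) \<le> real t"
    unfolding sum_divide_distrib[symmetric] c_def emp_mean_def by simp
  hence le: "(\<Sum>i = 1..t. y i / c - 1) \<le> 0" by (simp add: sum_subtractf)
  have "wealth t x y c \<le> (\<Prod>i = 1..t. exp ((1 - x) * (y i / c - 1)))"
    unfolding wealth_def
  proof (rule prod_mono, intro conjI)
    fix i assume i: "i \<in> {1..t}"
    show "0 \<le> x + (1 - x) * (y i / c)"
      using assms(1,2) c y[OF i] by (intro add_nonneg_nonneg mult_nonneg_nonneg) auto
    have "x + (1 - x) * (y i / c) = 1 + (1 - x) * (y i / c - 1)" by (simp add: algebra_simps)
    also have "\<dots> \<le> exp ((1 - x) * (y i / c - 1))" by (rule exp_ge_add_one_self)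
    finally show "x + (1 - x) * (y i / c) \<le> exp ((1 - x) * (y i / c - 1))" .
  qed
  also have "\<dots> = exp ((1 - x) * (\<Sum>i = 1..t. y i / c - 1))"
    by (simp add: exp_sum sum_distrib_left)
  also have "\<dots> \<le> 1" using le assms(2) by (simp add: mult_le_0_iff)
  finally show ?thesis by (simp add: c_def)
qed

lemma mixture_emp_mean_le:
  assumes "t \<ge> 1" "\<And>i. i \<in> {1..t} \<Longrightarrow> 0 \<le> y i"
  shows "mixture n t \<rho> \<eta> y (emp_mean t y) \<le> Zn n \<rho> \<eta>"
  unfolding Zn_def mixture_def
proof (rule nn_integral_mono)
  fix x :: real
  show "ennreal (wealth t x y (emp_mean t y) * phi n \<rho> \<eta> x) * indicator {0<..<1} x
      \<le> ennreal (phi n \<rho> \<eta> x) * indicator {0<..<1} x"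
    using wealth_emp_mean_le_1[of x t y] assms phi_pos[of n \<rho> \<eta> x]
    by (auto split: split_indicator intro!: ennreal_leI mult_left_le_one_le wealth_nonneg
        simp: mult_left_le_one_le)
qed

section \<open>Largest intervals\<close>

text \<open>All admissible intervals contain \<open>c\<close>, or all start at \<open>c = 0\<close>,
  or all end at \<open>c = 1\<close>, so their union is again an interval. Its ends are the infimum
  of the left ends and the supremum of the right ends.\<close>

lemma ex_largest_interval_around:
  assumes S: "S \<subseteq> {0<..<1::real}" and q: "interval_around c S q"
  shows "\<exists>p. largest_interval_around c S p"
proof -
  define Q where "Q = Collect (interval_around c S)"
  define L U where "L = Inf (fst ` Q)" and "U = Sup (snd ` Q)"
  have qQ: "q \<in> Q" using q by (simp add: Q_def)
  have Q01: "0 \<le> fst r \<and> fst r < snd r \<and> snd r \<le> 1 \<and> {fst r<..<snd r} \<subseteq> S" if "r \<in> Q" for r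
  proof -
    have *: "fst r < snd r" "{fst r<..<snd r} \<subseteq> S" using that by (auto simp: Q_def interval_around_def)
    hence "{fst r<..<snd r} \<subseteq> {0<..<1}" using S by blast
    thus ?thesis using * by (auto simp: greaterThanLessThan_subseteq_greaterThanLessThan)
  qed
  have bdd: "bdd_below (fst ` Q)" "bdd_above (snd ` Q)"
    using Q01 by (auto intro!: bdd_belowI[of _ 0] bdd_aboveI[of _ 1] dest!: Q01)
  have LU: "L \<le> fst r" "snd r \<le> U" if "r \<in> Q" for r
    unfolding L_def U_def using that bdd by (auto intro!: cInf_lower cSup_upper)
  have "L < U" using LU[OF qQ] Q01[OF qQ] by linarith
  have c: "c \<in> {fst r<..<snd r} \<or> (c = 0 \<and> fst r = 0) \<or> (c = 1 \<and> snd r = 1)" if "r \<in> Q" for r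
    using that by (auto simp: Q_def interval_around_def)
  have "{L<..<U} \<subseteq> S"
  proof
    fix x assume x: "x \<in> {L<..<U}"
    have "Inf (fst ` Q) < x" "x < Sup (snd ` Q)" "Q \<noteq> {}" using x qQ by (auto simp: L_def U_def)
    hence "\<exists>r\<in>Q. fst r < x" "\<exists>r\<in>Q. x < snd r"
      using cInf_less_iff[OF _ bdd(1)] less_cSup_iff[OF _ bdd(2)] by auto
    then obtain r r' where r: "r \<in> Q" "fst r < x" and r': "r' \<in> Q" "x < snd r'" by blast
    \<comment> \<open>Otherwise \<open>r\<close> would lie to the left of \<open>x\<close> and
      \<open>r'\<close> to the right, which their common position relative to \<open>c\<close>
      forbids.\<close>
    have "x \<in> {fst r<..<snd r} \<or> x \<in> {fst r'<..<snd r'}"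
      using c[OF r(1)] c[OF r'(1)] Q01[OF r(1)] Q01[OF r'(1)] r r' by auto
    thus "x \<in> S" using Q01[OF r(1)] Q01[OF r'(1)] by auto
  qed
  moreover have "c \<in> {L<..<U} \<or> (c = 0 \<and> L = 0) \<or> (c = 1 \<and> U = 1)"
  proof -
    have "0 \<le> L" "U \<le> 1"
      unfolding L_def U_def using qQ Q01 by (auto intro!: cInf_greatest cSup_least)
    thus ?thesis using c[OF qQ] LU[OF qQ] by auto
  qed
  ultimately have "interval_around c S (L, U)" using \<open>L < U\<close> by (simp add: interval_around_def)
  moreover have "{fst r<..<snd r} \<subseteq> {L<..<U}" if "interval_around c S r" for r
    using LU[of r] that by (auto simp: Q_def)
  ultimately show ?thesis unfolding largest_interval_around_def by (intro exI[of _ "(L, U)"]) auto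
qed

text \<open>This eliminates the definite description. A nonempty open interval determines its end
  points, so the largest one is unique. If there is none, then no admissible interval exists at all,
  and the default \<open>(c, c)\<close> contains no point either.\<close>

lemma mem_interval_bounds_iff:
  assumes S: "S \<subseteq> {0<..<1::real}"
  shows "m \<in> {fst (interval_bounds c S)<..<snd (interval_bounds c S)} \<longleftrightarrow>
    (\<exists>q. interval_around c S q \<and> m \<in> {fst q<..<snd q})"
proof (cases "\<exists>p. largest_interval_around c S p")
  case False
  hence "\<nexists>q. interval_around c S q" using ex_largest_interval_around[OF S] by blast
  thus ?thesis using False by (auto simp: interval_bounds_def)
next
  case True
  then obtain p where p: "largest_interval_around c S p" by blast
  have "r = p" if "largest_interval_around c S r" for r
  proof -
    have I: "interval_around c S r" "interval_around c S p"
      using p that by (simp_all add: largest_interval_around_def)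
    have "{fst r<..<snd r} \<subseteq> {fst p<..<snd p}" "{fst p<..<snd p} \<subseteq> {fst r<..<snd r}"
      using p that I unfolding largest_interval_around_def by blast+
    moreover have "fst r < snd r" "fst p < snd p"
      using I by (simp_all add: interval_around_def case_prod_beta)
    ultimately show ?thesis
      unfolding prod_eq_iff greaterThanLessThan_subseteq_greaterThanLessThan by linarith
  qed
  hence "(THE r. largest_interval_around c S r) = p" using p by (intro the_equality)
  hence eq: "interval_bounds c S = p" using True unfolding interval_bounds_def by simp
  have "interval_around c S p" "interval_around c S q \<Longrightarrow> {fst q<..<snd q} \<subseteq> {fst p<..<snd p}" for q
    using p by (simp_all only: largest_interval_around_def)
  thus ?thesis unfolding eq by blast
qed

text \<open>In one direction, intervals are convex. In the other, openness of \<open>S\<close> lets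
  the segment from \<open>m\<close> to \<open>c\<close> be widened beyond its ends. The segment
  stops short of \<open>c\<close> because \<open>c\<close> lies outside \<open>S\<close> when it is
  \<open>0\<close> or \<open>1\<close>.\<close>

lemma ex_interval_around_iff:
  assumes S: "open S" "S \<subseteq> {0<..<1::real}" and c: "0 \<le> c" "c \<le> 1"
  shows "(\<exists>q. interval_around c S q \<and> m \<in> {fst q<..<snd q}) \<longleftrightarrow>
    (\<forall>s\<in>{0..<1}. m + s * (c - m) \<in> S) \<and> (c \<in> {0<..<1} \<longrightarrow> c \<in> S)"
proof (intro iffI conjI ballI impI)
  assume "\<exists>q. interval_around c S q \<and> m \<in> {fst q<..<snd q}"
  then obtain q where q: "interval_around c S q" "m \<in> {fst q<..<snd q}" by blast
  hence sub: "{fst q<..<snd q} \<subseteq> S" by (auto simp: interval_around_def)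
  hence "{fst q<..<snd q} \<subseteq> {0<..<1}" using S(2) by blast
  moreover have "fst q < snd q" using q by auto
  ultimately have q01: "0 \<le> fst q" "snd q \<le> 1"
    by (auto simp: greaterThanLessThan_subseteq_greaterThanLessThan)
  have cq: "fst q \<le> c" "c \<le> snd q" "c \<in> {0<..<1} \<Longrightarrow> c \<in> {fst q<..<snd q}"
    using q q01 by (auto simp: interval_around_def)
  show "m + s * (c - m) \<in> S" if "s \<in> {0..<1}" for s
  proof -
    have "0 < (1 - s) * (m - fst q)" "0 < (1 - s) * (snd q - m)" "0 \<le> s * (c - fst q)" "0 \<le> s * (snd q - c)"
      using q(2) that cq by auto
    hence "fst q < m + s * (c - m)" "m + s * (c - m) < snd q" by (auto simp: algebra_simps)
    thus ?thesis using sub by auto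
  qed
  show "c \<in> S" if "c \<in> {0<..<1}" using cq(3)[OF that] sub by auto
next
  assume *: "(\<forall>s\<in>{0..<1}. m + s * (c - m) \<in> S) \<and> (c \<in> {0<..<1} \<longrightarrow> c \<in> S)"
  hence mS: "m \<in> S" by (auto dest!: bspec[of _ _ 0])
  hence m01: "0 < m" "m < 1" using S(2) by auto
  have seg: "x \<in> S" if "x \<in> {0<..<1}" "min c m \<le> x" "x \<le> max c m" for x
  proof (cases "x = c")
    case True
    thus ?thesis using * that by auto
  next
    case False
    hence "c \<noteq> m" using that by auto
    define s where "s = (x - m) / (c - m)"
    have "x = m + s * (c - m)" using \<open>c \<noteq> m\<close> by (simp add: s_def)
    moreover have "0 \<le> s" "s < 1"
      using that False \<open>c \<noteq> m\<close> by (auto simp: s_def divide_simps min_def max_def split: if_splits)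
    ultimately show ?thesis using * by auto
  qed
  have nbhd: "\<exists>e>0. {x - e<..<x + e} \<subseteq> S" if "x \<in> S" for x
  proof -
    have "\<exists>e>0. \<forall>y. dist y x < e \<longrightarrow> y \<in> S" using S(1) that unfolding open_dist by blast
    then obtain e where "e > 0" "\<forall>y. dist y x < e \<longrightarrow> y \<in> S" by blast
    thus ?thesis by (intro exI[of _ e]) (auto simp: dist_real_def)
  qed
  define a b where "a = min c m" and "b = max c m"
  \<comment> \<open>The left end is \<open>0\<close> if \<open>c = 0\<close>; otherwise openness of
    \<open>S\<close> at \<open>a\<close> allows a step below \<open>a\<close>, cut off at
    \<open>0\<close>. The right end is found in the same way.\<close>
  obtain l where l: "0 \<le> l" "l \<le> a" "l < m" "c = 0 \<longrightarrow> l = 0" "c > 0 \<longrightarrow> l < a" "{l<..<m} \<subseteq> S"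
  proof (cases "c = 0")
    case True
    hence "{0<..<m} \<subseteq> S" using m01 seg by auto
    thus ?thesis using m01 True that[of 0] by (simp add: a_def)
  next
    case False
    hence "a \<in> S" using c m01 seg[of a] by (auto simp: a_def min_def)
    then obtain e where e: "e > 0" "{a - e<..<a + e} \<subseteq> S" using nbhd by blast
    have "a > 0" using False c m01 by (auto simp: a_def)
    have "x \<in> S" if "max 0 (a - e) < x" "x < m" for x
      using e seg[of x] that m01 by (cases "x < a") (auto simp: a_def)
    hence "{max 0 (a - e)<..<m} \<subseteq> S" by auto
    thus ?thesis using that[of "max 0 (a - e)"] e \<open>a > 0\<close> False
      by (simp add: a_def)
  qed
  obtain u where u: "u \<le> 1" "b \<le> u" "m < u" "c = 1 \<longrightarrow> u = 1" "c < 1 \<longrightarrow> b < u" "{m<..<u} \<subseteq> S"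
  proof (cases "c = 1")
    case True
    hence "{m<..<1} \<subseteq> S" using m01 seg by auto
    thus ?thesis using m01 True that[of 1] by (simp add: b_def)
  next
    case False
    hence "b \<in> S" using c m01 seg[of b] by (auto simp: b_def max_def)
    then obtain e where e: "e > 0" "{b - e<..<b + e} \<subseteq> S" using nbhd by blast
    have "b < 1" using False c m01 by (auto simp: b_def)
    have "x \<in> S" if "x < min 1 (b + e)" "m < x" for x
      using e seg[of x] that m01 by (cases "x > b") (auto simp: b_def)
    hence "{m<..<min 1 (b + e)} \<subseteq> S" by auto
    thus ?thesis using that[of "min 1 (b + e)"] e \<open>b < 1\<close> False
      by (simp add: b_def)
  qed
  have "{l<..<u} \<subseteq> S"
  proof
    fix x assume "x \<in> {l<..<u}"
    thus "x \<in> S" using l u mS by (cases x m rule: linorder_cases) auto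
  qed
  hence "interval_around c S (l, u)"
    using l u c by (auto simp: interval_around_def a_def b_def)
  thus "\<exists>q. interval_around c S q \<and> m \<in> {fst q<..<snd q}"
    using l u by (intro exI[of _ "(l, u)"]) auto
qed

section \<open>Continuity and sublevel sets\<close>

text \<open>Provides the majorant for dominated convergence, from
  \<open>(1 - x) ^ k / real k \<le> 1\<close> and \<open>\<eta>' * ln x \<le> 0\<close>. The sign of
  \<open>\<eta>'\<close> comes from the even powers in \<open>eta_n\<close>.\<close>

lemma phi_add_le:
  assumes x: "0 < x" "x < 1" and \<eta>': "0 \<le> \<eta>'" and B: "\<And>k. k \<in> {1..2*n-1} \<Longrightarrow> \<bar>\<rho>' k\<bar> \<le> B k"
  shows "phi n (\<lambda>k. \<rho>' k + \<rho> k) (\<eta>' + \<eta>) x \<le> exp (\<Sum>k = 1..2*n-1. B k) * phi n \<rho> \<eta> x"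
proof -
  have "(\<Sum>k = 1..2*n-1. (1 - x) ^ k / real k * \<rho>' k) \<le> (\<Sum>k = 1..2*n-1. B k)"
  proof (rule sum_mono)
    fix k assume k: "k \<in> {1..2*n-1}"
    have "(1 - x) ^ k \<le> 1" using x by (intro power_le_one) auto
    hence "(1 - x) ^ k / real k \<le> 1" using k by (simp add: divide_le_eq)
    have "(1 - x) ^ k / real k * \<rho>' k \<le> (1 - x) ^ k / real k * \<bar>\<rho>' k\<bar>"
      using x by (intro mult_left_mono) auto
    also have "\<dots> \<le> 1 * \<bar>\<rho>' k\<bar>"
      using \<open>(1 - x) ^ k / real k \<le> 1\<close> by (intro mult_right_mono) auto
    finally show "(1 - x) ^ k / real k * \<rho>' k \<le> B k" using B[OF k] by simp
  qed
  moreover have "\<eta>' * ln x \<le> 0" using x \<eta>' by (intro mult_nonneg_nonpos) auto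
  ultimately show ?thesis
    unfolding phi_add using phi_pos[of n \<rho> \<eta> x] by (intro mult_right_mono) auto
qed

text \<open>A convergent sequence of parameters is bounded, so a multiple of the prior density,
  integrable since \<open>Zn n \<rho> \<eta>\<close> is finite, dominates all integrands. Finiteness
  of the limit is recorded because multiplication in \<open>ennreal\<close> is discontinuous at
  \<open>0\<close> times infinity.\<close>

lemma tendsto_Zn:
  assumes fin: "Zn n \<rho> \<eta> < \<infinity>" and \<eta>': "\<And>j. 0 \<le> \<eta>' j" "\<eta>' \<longlonglongrightarrow> l"
    and \<rho>': "\<And>k. k \<in> {1..2*n-1} \<Longrightarrow> (\<lambda>j. \<rho>' j k) \<longlonglongrightarrow> r k"
  shows "(\<lambda>j. Zn n (\<lambda>k. \<rho>' j k + \<rho> k) (\<eta>' j + \<eta>)) \<longlonglongrightarrow> Zn n (\<lambda>k. r k + \<rho> k) (l + \<eta>)"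
    and "Zn n (\<lambda>k. r k + \<rho> k) (l + \<eta>) < \<infinity>"
proof -
  have "\<exists>B. \<forall>j. \<bar>\<rho>' j k\<bar> \<le> B" if "k \<in> {1..2*n-1}" for k
    using convergent_imp_Bseq[OF convergentI[OF \<rho>'[OF that]]] by (auto simp: Bseq_def)
  then obtain B where B: "\<And>k j. k \<in> {1..2*n-1} \<Longrightarrow> \<bar>\<rho>' j k\<bar> \<le> B k" by metis
  define w where "w = (\<lambda>x. ennreal (exp (\<Sum>k = 1..2*n-1. B k)) * (ennreal (phi n \<rho> \<eta> x) * indicator {0<..<1} x))"
  have [measurable]: "w \<in> borel_measurable lborel" unfolding w_def by measurable
  have w: "(\<integral>\<^sup>+x. w x \<partial>lborel) < \<infinity>"
    using fin unfolding w_def Zn_def by (subst nn_integral_cmult) (auto simp: ennreal_mult_less_top)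
  let ?u = "\<lambda>j x. ennreal (phi n (\<lambda>k. \<rho>' j k + \<rho> k) (\<eta>' j + \<eta>) x) * indicator {0<..<1} x"
  let ?v = "\<lambda>x. ennreal (phi n (\<lambda>k. r k + \<rho> k) (l + \<eta>) x) * indicator {0<..<1} x"
  have bound: "?u j x \<le> w x" for j x
    using phi_add_le[of x "\<eta>' j" n "\<rho>' j" B \<rho> \<eta>] B \<eta>'(1) phi_pos[of n \<rho> \<eta> x]
    by (auto simp: w_def ennreal_mult[symmetric] less_imp_le intro!: ennreal_leI split: split_indicator)
  have lim: "(\<lambda>j. ?u j x) \<longlonglongrightarrow> ?v x" for x
  proof (cases "x \<in> {0<..<1}")
    case True
    have "(\<lambda>j. phi n (\<lambda>k. \<rho>' j k + \<rho> k) (\<eta>' j + \<eta>) x) \<longlonglongrightarrow> phi n (\<lambda>k. r k + \<rho> k) (l + \<eta>) x"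
      unfolding phi_def by (intro tendsto_intros \<eta>' \<rho>')
    thus ?thesis using True by simp
  qed simp
  show "(\<lambda>j. Zn n (\<lambda>k. \<rho>' j k + \<rho> k) (\<eta>' j + \<eta>)) \<longlonglongrightarrow> Zn n (\<lambda>k. r k + \<rho> k) (l + \<eta>)"
    unfolding Zn_def using bound lim w by (intro nn_integral_dominated_convergence[where w = w]) auto
  have "?v x \<le> w x" for x
    by (rule LIMSEQ_le_const2[OF lim]) (use bound in auto)
  hence "(\<integral>\<^sup>+x. ?v x \<partial>lborel) \<le> (\<integral>\<^sup>+x. w x \<partial>lborel)" by (intro nn_integral_mono)
  thus "Zn n (\<lambda>k. r k + \<rho> k) (l + \<eta>) < \<infinity>" unfolding Zn_def using w by (rule le_less_trans)
qed

lemma eta_n_nonneg: "0 \<le> eta_n n t y m"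
  unfolding eta_n_def by (intro sum_nonneg) auto

lemma h_breve_eq_0:
  assumes "Zn n \<rho>1 \<eta>1 = \<infinity> \<or> Zn n \<rho>2 \<eta>2 = \<infinity>" "0 < m" "m < 1"
  shows "h_breve n t m y \<rho>1 \<eta>1 \<rho>2 \<eta>2 = 0"
  using assms by (auto simp: h_breve_def ennreal_mult_top)

lemma denominator_bounds:
  assumes "Zn n \<rho>1 \<eta>1 < \<infinity>" "Zn n \<rho>2 \<eta>2 < \<infinity>" "0 < m" "m < 1"
  shows "ennreal (1 - m) * Zn n \<rho>1 \<eta>1 + ennreal m * Zn n \<rho>2 \<eta>2 \<noteq> 0"
    "ennreal (1 - m) * Zn n \<rho>1 \<eta>1 + ennreal m * Zn n \<rho>2 \<eta>2 < \<infinity>"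
  using assms Zn_pos[of n \<rho>1 \<eta>1] by (auto simp: ennreal_mult_less_top)

text \<open>Continuity makes the sublevel sets open, as \<open>ex_interval_around_iff\<close>
  requires, and later lets the segment be tested at rational points. For an improper prior the
  function is constantly \<open>0\<close>.\<close>

lemma continuous_on_h_breve:
  "continuous_on {0<..<1} (\<lambda>m. h_breve n t m y \<rho>1 \<eta>1 \<rho>2 \<eta>2)"
proof (cases "Zn n \<rho>1 \<eta>1 < \<infinity> \<and> Zn n \<rho>2 \<eta>2 < \<infinity>")
  case False
  hence "h_breve n t m y \<rho>1 \<eta>1 \<rho>2 \<eta>2 = 0" if "m \<in> {0<..<1}" for m
    using that by (intro h_breve_eq_0) (auto simp: less_top[symmetric])
  hence "continuous_on {0<..<1} (\<lambda>m. h_breve n t m y \<rho>1 \<eta>1 \<rho>2 \<eta>2)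
      \<longleftrightarrow> continuous_on {0<..<1::real} (\<lambda>_. 0 :: ennreal)"
    by (intro continuous_on_cong refl)
  thus ?thesis by simp
next
  case True
  show ?thesis unfolding continuous_on_sequentially
  proof (intro allI ballI impI, elim conjE)
    fix m :: "nat \<Rightarrow> real" and a assume a: "a \<in> {0<..<1}" and m: "\<forall>j. m j \<in> {0<..<1}" "m \<longlonglongrightarrow> a"
    have a0: "a \<noteq> 0" "1 - a \<noteq> 0" using a by auto
    have m': "(\<lambda>j. 1 - m j) \<longlonglongrightarrow> 1 - a" by (intro tendsto_intros m)
    \<comment> \<open>Stated for arbitrary \<open>m\<close>, \<open>y\<close> and \<open>a\<close>,
      so that it also serves for the reflected arguments.\<close>
    have e: "(\<lambda>j. eta_n n t y (m j)) \<longlonglongrightarrow> eta_n n t y a"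
        "(\<lambda>j. rho_n n t y (m j) k) \<longlonglongrightarrow> rho_n n t y a k" if "m \<longlonglongrightarrow> a" "a \<noteq> 0" for m y a k
      unfolding eta_n_def rho_n_def using that by (auto intro!: tendsto_intros)
    note lim1 = tendsto_Zn[of n \<rho>1 \<eta>1, OF _ eta_n_nonneg e[OF m(2) a0(1)]]
    note lim2 = tendsto_Zn[of n \<rho>2 \<eta>2, OF _ eta_n_nonneg e[OF m' a0(2)]]
    \<comment> \<open>Inversion is continuous on all of \<open>ennreal\<close>. The quotient is
      treated as a product with the inverse, where a finite numerator and a nonzero denominator
      exclude \<open>0\<close> times infinity.\<close>
    have inv: "(\<lambda>j. inverse (f j)) \<longlonglongrightarrow> inverse l" if "f \<longlonglongrightarrow> l" for f :: "nat \<Rightarrow> ennreal" and l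
      using continuous_on_tendsto_compose[OF continuous_on_inverse_ennreal[OF continuous_on_id, of UNIV] that] by simp
    note db = denominator_bounds[of n \<rho>1 \<eta>1 \<rho>2 \<eta>2 a]
    show "((\<lambda>m. h_breve n t m y \<rho>1 \<eta>1 \<rho>2 \<eta>2) \<circ> m) \<longlonglongrightarrow> h_breve n t a y \<rho>1 \<eta>1 \<rho>2 \<eta>2"
      unfolding h_breve_def o_def divide_ennreal_def
      using True a db lim1(2) lim2(2)
      by (intro tendsto_mult_ennreal tendsto_add tendsto_ennrealI m m' lim1(1) lim2(1) tendsto_const inv)
         (auto simp: ennreal_inverse_eq_top_iff less_top[symmetric])
  qed
qed

lemma open_sublevel_set: "open (sublevel_set n t y \<rho>1 \<eta>1 \<rho>2 \<eta>2 \<delta>)"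
proof -
  have "sublevel_set n t y \<rho>1 \<eta>1 \<rho>2 \<eta>2 \<delta>
      = (\<lambda>m. h_breve n t m y \<rho>1 \<eta>1 \<rho>2 \<eta>2) -` {..<ennreal (1 / \<delta>)} \<inter> {0<..<1}"
    by (auto simp: sublevel_set_def)
  thus ?thesis
    using continuous_on_h_breve[of n t y \<rho>1 \<eta>1 \<rho>2 \<eta>2] by (auto simp: continuous_on_open_vimage)
qed

section \<open>A convex majorant of the numerator along the segment to the empirical mean\<close>

text \<open>The mixture \<open>(1 - m) A(m) + m B(m)\<close>: capital is split between bets on large
  and on small observations, the second bet being the first one for the reflected sample and the
  mean \<open>1 - m\<close>.\<close>

definition game_value :: "nat \<Rightarrow> nat \<Rightarrow> (nat \<Rightarrow> real) \<Rightarrow>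
    (nat \<Rightarrow> real) \<Rightarrow> real \<Rightarrow> (nat \<Rightarrow> real) \<Rightarrow> real \<Rightarrow> real \<Rightarrow> ennreal" where
  "game_value n t y \<rho>1 \<eta>1 \<rho>2 \<eta>2 m =
     ennreal (1 - m) * mixture n t \<rho>1 \<eta>1 y m
     + ennreal m * mixture n t \<rho>2 \<eta>2 (\<lambda>i. 1 - y i) (1 - m)"

lemma h_breve_le:
  assumes "n \<ge> 1" "0 < m" "m < 1" "\<And>i. i \<in> {1..t} \<Longrightarrow> y i \<in> {0..1}"
  shows "h_breve n t m y \<rho>1 \<eta>1 \<rho>2 \<eta>2
    \<le> game_value n t y \<rho>1 \<eta>1 \<rho>2 \<eta>2 m / (ennreal (1 - m) * Zn n \<rho>1 \<eta>1 + ennreal m * Zn n \<rho>2 \<eta>2)"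
  unfolding h_breve_def game_value_def using assms
  by (intro divide_right_mono_ennreal add_mono mult_left_mono Zn_le_mixture) auto

text \<open>The last claim holds because a nonnegative sample with mean \<open>0\<close> vanishes
  identically; it makes the empirical mean an admissible end point for
  \<open>mixture_convex\<close>.\<close>

lemma emp_mean_bounds:
  assumes "t \<ge> 1" "\<And>i. i \<in> {1..t} \<Longrightarrow> y i \<in> {0..1}"
  shows "0 \<le> emp_mean t y" "emp_mean t y \<le> 1" "emp_mean t (\<lambda>i. 1 - y i) = 1 - emp_mean t y"
    "emp_mean t y \<in> wealth_dom t y"
proof -
  have "(\<Sum>i = 1..t. y i) \<le> (\<Sum>i = 1..t. 1)" using assms by (intro sum_mono) auto
  thus *: "0 \<le> emp_mean t y" "emp_mean t y \<le> 1" "emp_mean t (\<lambda>i. 1 - y i) = 1 - emp_mean t y"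
    using assms by (auto simp: emp_mean_def sum_subtractf diff_divide_distrib
        intro!: divide_nonneg_nonneg sum_nonneg)
  have "\<forall>i\<in>{1..t}. y i = 0" if "emp_mean t y = 0"
    using that assms sum_nonneg_eq_0_iff[of "{1..t}" y] by (auto simp: emp_mean_def)
  thus "emp_mean t y \<in> wealth_dom t y" using * by (auto simp: wealth_dom_def)
qed

text \<open>The set where \<open>game_value\<close> is small is an interval although that of \<open>h_breve\<close> need not be one.\<close>

lemma segment_subset_sublevel_set:
  assumes n: "n \<ge> 1" and t: "t \<ge> 1" and y: "\<And>i. i \<in> {1..t} \<Longrightarrow> y i \<in> {0..1}" and \<delta>: "0 < \<delta>" "\<delta> < 1"
    and fin: "Zn n \<rho>1 \<eta>1 < \<infinity>" "Zn n \<rho>2 \<eta>2 < \<infinity>" and \<mu>: "0 < \<mu>" "\<mu> < 1"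
    and less: "game_value n t y \<rho>1 \<eta>1 \<rho>2 \<eta>2 \<mu>
      < ennreal (1 / \<delta>) * (ennreal (1 - \<mu>) * Zn n \<rho>1 \<eta>1 + ennreal \<mu> * Zn n \<rho>2 \<eta>2)"
    and s: "0 \<le> s" "s \<le> 1" and m: "m = \<mu> + s * (emp_mean t y - \<mu>)" "0 < m" "m < 1"
  shows "m \<in> sublevel_set n t y \<rho>1 \<eta>1 \<rho>2 \<eta>2 \<delta>"
proof -
  define c where "c = emp_mean t y"
  define G where "G = game_value n t y \<rho>1 \<eta>1 \<rho>2 \<eta>2"
  define V where "V = (\<lambda>m. ennreal (1 - m) * Zn n \<rho>1 \<eta>1 + ennreal m * Zn n \<rho>2 \<eta>2)"
  define K where "K = ennreal (1 / \<delta>)"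
  define y' where "y' = (\<lambda>i. 1 - y i)"
  have y': "y' i \<in> {0..1}" if "i \<in> {1..t}" for i using y[OF that] by (auto simp: y'_def)
  have c: "0 \<le> c" "c \<le> 1" "emp_mean t y' = 1 - c" "c \<in> wealth_dom t y" "1 - c \<in> wealth_dom t y'"
    using emp_mean_bounds[OF t y] emp_mean_bounds[OF t y'] by (auto simp: c_def y'_def)
  have \<mu>D: "\<mu> \<in> wealth_dom t y" "1 - \<mu> \<in> wealth_dom t y'" using \<mu> by (auto simp: wealth_dom_def)
  have mc: "m = (1 - s) * \<mu> + s * c" "1 - m = (1 - s) * (1 - \<mu>) + s * (1 - c)"
    by (auto simp: m c_def algebra_simps)
  have "G m \<le> (ennreal (1 - s) * (ennreal (1 - \<mu>) * mixture n t \<rho>1 \<eta>1 y \<mu>)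
        + ennreal s * (ennreal (1 - c) * mixture n t \<rho>1 \<eta>1 y c))
      + (ennreal (1 - s) * (ennreal (1 - (1 - \<mu>)) * mixture n t \<rho>2 \<eta>2 y' (1 - \<mu>))
        + ennreal s * (ennreal (1 - (1 - c)) * mixture n t \<rho>2 \<eta>2 y' (1 - c)))"
    using mixture_convex[OF s \<mu>D(1) c(4), of n \<rho>1 \<eta>1] mixture_convex[OF s \<mu>D(2) c(5), of n \<rho>2 \<eta>2]
      y y' unfolding G_def game_value_def mc(1)[symmetric] mc(2)[symmetric] y'_def[symmetric]
    by (intro add_mono) auto
  also have "\<dots> = ennreal (1 - s) * G \<mu> + ennreal s * G c"
    unfolding G_def game_value_def y'_def[symmetric] by (simp add: distrib_left algebra_simps)
  finally have Gm: "G m \<le> ennreal (1 - s) * G \<mu> + ennreal s * G c" .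
  \<comment> \<open>The initial value is affine in \<open>m\<close>, so bounding a convex function
    by \<open>K\<close> times it at both ends bounds it on the whole segment.\<close>
  have Vm: "V m = ennreal (1 - s) * V \<mu> + ennreal s * V c"
  proof -
    have "ennreal (1 - m) = ennreal (1 - s) * ennreal (1 - \<mu>) + ennreal s * ennreal (1 - c)"
      "ennreal m = ennreal (1 - s) * ennreal \<mu> + ennreal s * ennreal c"
      using s c \<mu> mc by (auto simp flip: ennreal_mult ennreal_plus)
    thus ?thesis by (simp add: V_def algebra_simps)
  qed
  \<comment> \<open>The closed range matters: \<open>u\<close> is also taken as \<open>c\<close>,
    which may be \<open>0\<close> or \<open>1\<close>.\<close>
  have V: "0 < V u" "V u < top" if "0 \<le> u" "u \<le> 1" for u
    using that fin Zn_pos[of n \<rho>1 \<eta>1] Zn_pos[of n \<rho>2 \<eta>2]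
    by (cases "u = 0"; auto simp: V_def ennreal_mult_less_top ennreal_zero_less_mult_iff add_nonneg_pos)+
  \<comment> \<open>\<open>\<delta> < 1\<close> gives \<open>K > 1\<close>, which turns
    \<open>G c \<le> V c\<close> into a strict bound at \<open>c\<close>.\<close>
  have K: "1 < K" "K < top" using \<delta> by (auto simp: K_def ennreal_less_iff simp flip: ennreal_1)
  have "G c \<le> V c"
    using mixture_emp_mean_le[OF t, of y n \<rho>1 \<eta>1] mixture_emp_mean_le[OF t, of y' n \<rho>2 \<eta>2] y y' c
    unfolding G_def V_def game_value_def y'_def[symmetric] c_def[symmetric]
    by (intro add_mono mult_left_mono) auto
  also have "V c < K * V c"
    using V[OF c(1,2)] ennreal_mult_strict_right_mono[OF K(1)] by simp
  finally have Gc: "G c < K * V c" .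
  have G\<mu>: "G \<mu> < K * V \<mu>" using less by (simp add: G_def K_def V_def)
  have "G m < K * V m"
  \<comment> \<open>For \<open>s = 0\<close> the strict bound comes from \<open>\<mu>\<close>.
    Otherwise it comes from \<open>c\<close>, and cancelling the other summand requires that to be
    finite.\<close>
  proof (cases "s = 0")
    case True
    thus ?thesis using G\<mu> mc by simp
  next
    case False
    have fin': "ennreal (1 - s) * G \<mu> < top" using order.strict_trans2[OF G\<mu> top_greatest] by (simp add: ennreal_mult_less_top)
    note Gm
    also have "ennreal (1 - s) * G \<mu> + ennreal s * G c < ennreal (1 - s) * G \<mu> + ennreal s * (K * V c)"
      using fin' False s Gc by (auto simp: ennreal_add_left_cancel_less intro!: ennreal_mult_strict_left_mono)
    also have "\<dots> \<le> ennreal (1 - s) * (K * V \<mu>) + ennreal s * (K * V c)"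
      using G\<mu> by (intro add_mono mult_left_mono) auto
    also have "\<dots> = K * V m" by (simp add: Vm algebra_simps)
    finally show ?thesis .
  qed
  hence "G m / V m < K" using V[of m] m by (subst divide_less_ennreal) auto
  thus ?thesis
    using le_less_trans[OF h_breve_le[OF n m(2,3) y]] m(2,3)
    by (auto simp: sublevel_set_def G_def V_def K_def)
qed

section \<open>Measurability of the miscoverage event\<close>

text \<open>For measurability, a quantifier over an uncountable set is replaced by countably many
  suprema over countable sets. On each compact interval the continuous \<open>g\<close> attains its
  maximum, so the supremum stays strictly below \<open>K\<close>.\<close>

lemma all_less_iff_SUP_Rats_less:
  fixes g :: "real \<Rightarrow> ennreal"
  assumes g: "continuous_on {0..<1} g"
  shows "(\<forall>s\<in>{0..<1}. g s < K) \<longleftrightarrow> (\<forall>j::nat. (SUP q\<in>{0..1 - 1 / real (Suc j)} \<inter> \<rat>. g q) < K)"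
proof (intro iffI allI ballI)
  fix j :: nat
  assume less: "\<forall>s\<in>{0..<1}. g s < K"
  define I where "I = {0..1 - 1 / real (Suc j)}"
  have d: "0 < 1 / real (Suc j)" "1 / real (Suc j) \<le> 1" by simp_all
  have "0 \<in> I" using d(2) unfolding I_def atLeastAtMost_iff by linarith
  moreover have "I \<subseteq> {0..<1}"
  proof
    fix x assume "x \<in> I"
    thus "x \<in> {0..<1}" using d(1) unfolding I_def atLeastAtMost_iff atLeastLessThan_iff by linarith
  qed
  ultimately have I: "0 \<in> I" "I \<subseteq> {0..<1}" by blast+
  obtain x where x: "x \<in> I" "\<And>y. y \<in> I \<Longrightarrow> g y \<le> g x"
    using continuous_attains_sup[of I g] I continuous_on_subset[OF g I(2)] by (auto simp: I_def)
  have "(SUP q\<in>I \<inter> \<rat>. g q) \<le> g x" using x by (intro SUP_least) auto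
  also have "\<dots> < K" using less x I by auto
  finally show "(SUP q\<in>{0..1 - 1 / real (Suc j)} \<inter> \<rat>. g q) < K" by (simp add: I_def)
next
  fix s :: real
  assume *: "\<forall>j::nat. (SUP q\<in>{0..1 - 1 / real (Suc j)} \<inter> \<rat>. g q) < K" and s: "s \<in> {0..<1}"
  \<comment> \<open>\<open>s\<close> has to lie strictly below the right end, so that rationals
    above \<open>s\<close> can approximate it within the interval.\<close>
  obtain j where "inverse (real (Suc j)) < 1 - s" using reals_Archimedean[of "1 - s"] s by auto
  hence j: "s < 1 - 1 / real (Suc j)" by (simp add: inverse_eq_divide)
  define b where "b = 1 - 1 / real (Suc j)"
  have b: "s < b" "b < 1" using j by (auto simp: b_def)
  have "\<exists>r\<in>\<rat>. s < r \<and> r < min (s + inverse (real (Suc k))) b" for k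
    using Rats_dense_in_real[of s "min (s + inverse (real (Suc k))) b"] b by auto
  then obtain r where r: "\<And>k. r k \<in> \<rat>" "\<And>k. s < r k" "\<And>k. r k < s + inverse (real (Suc k))" "\<And>k. r k < b"
    unfolding min_less_iff_conj by metis
  have "(\<lambda>k. s + inverse (real (Suc k))) \<longlonglongrightarrow> s + 0"
    by (intro tendsto_intros LIMSEQ_inverse_real_of_nat)
  hence "r \<longlonglongrightarrow> s"
    using r by (intro tendsto_sandwich[OF _ _ tendsto_const[of s], of r sequentially "\<lambda>k. s + inverse (real (Suc k))"])
      (auto intro!: always_eventually less_imp_le)
  moreover have "r k \<in> {0..<1}" for k using r(2)[of k] r(4)[of k] b s by auto
  ultimately have "(\<lambda>k. g (r k)) \<longlonglongrightarrow> g s"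
    using s by (intro continuous_on_tendsto_compose[OF g]) auto
  moreover have "g (r k) \<le> (SUP q\<in>{0..b} \<inter> \<rat>. g q)" for k
    using r[of k] s by (intro SUP_upper) (auto intro: less_imp_le order.trans)
  ultimately have "g s \<le> (SUP q\<in>{0..b} \<inter> \<rat>. g q)"
    by (intro LIMSEQ_le_const2) auto
  thus "g s < K" using *[rule_format, of j] by (simp add: b_def)
qed

lemma measurable_Zn:
  assumes [measurable]: "\<And>k. k \<in> {1..2*n-1} \<Longrightarrow> R k \<in> borel_measurable M" "E \<in> borel_measurable M"
  shows "(\<lambda>\<omega>. Zn n (\<lambda>k. R k \<omega>) (E \<omega>)) \<in> borel_measurable M"
proof -
  have "(\<lambda>(\<omega>, x). ennreal (phi n (\<lambda>k. R k \<omega>) (E \<omega>) x) * indicator {0<..<1} x)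
    \<in> borel_measurable (M \<Otimes>\<^sub>M lborel)"
    unfolding phi_def by measurable
  thus ?thesis unfolding Zn_def by (rule lborel.borel_measurable_nn_integral)
qed

text \<open>The point of evaluation \<open>f\<close> may be random, since the segment from
  \<open>\<mu>\<close> to the empirical mean moves with the sample.\<close>

lemma measurable_h_breve:
  assumes [measurable]: "\<And>i. i \<in> {1..t} \<Longrightarrow> Y i \<in> borel_measurable M" "f \<in> borel_measurable M"
  shows "(\<lambda>\<omega>. h_breve n t (f \<omega>) (\<lambda>i. Y i \<omega>) \<rho>1 \<eta>1 \<rho>2 \<eta>2) \<in> borel_measurable M"
proof -
  have [measurable]: "(\<lambda>\<omega>. rho_n n t (\<lambda>i. X i \<omega>) (g \<omega>) k) \<in> borel_measurable M"
      "(\<lambda>\<omega>. eta_n n t (\<lambda>i. X i \<omega>) (g \<omega>)) \<in> borel_measurable M"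
    if [measurable]: "\<And>i. i \<in> {1..t} \<Longrightarrow> X i \<in> borel_measurable M" "g \<in> borel_measurable M" for X g k
    unfolding rho_n_def eta_n_def by measurable
  have Z: "(\<lambda>\<omega>. Zn n (\<lambda>k. rho_n n t (\<lambda>i. X i \<omega>) (g \<omega>) k + \<rho> k) (eta_n n t (\<lambda>i. X i \<omega>) (g \<omega>) + \<eta>))
      \<in> borel_measurable M"
    if [measurable]: "\<And>i. i \<in> {1..t} \<Longrightarrow> X i \<in> borel_measurable M" "g \<in> borel_measurable M" for X g \<rho> \<eta>
    by (rule measurable_Zn) (use that in measurable)
  note [measurable] = Z[of Y f] Z[of "\<lambda>i \<omega>. 1 - Y i \<omega>" "\<lambda>\<omega>. 1 - f \<omega>"]
  show ?thesis unfolding h_breve_def by measurable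
qed

lemma mem_interval_iff:
  assumes t: "t \<ge> 1" and y: "\<And>i. i \<in> {1..t} \<Longrightarrow> y i \<in> {0..1}"
  shows "\<mu> \<in> {mu_low n t y \<rho>1 \<eta>1 \<rho>2 \<eta>2 \<delta> <..< mu_up n t y \<rho>1 \<eta>1 \<rho>2 \<eta>2 \<delta>} \<longleftrightarrow>
    (\<forall>s\<in>{0..<1}. \<mu> + s * (emp_mean t y - \<mu>) \<in> sublevel_set n t y \<rho>1 \<eta>1 \<rho>2 \<eta>2 \<delta>)
    \<and> (emp_mean t y \<in> {0<..<1} \<longrightarrow> emp_mean t y \<in> sublevel_set n t y \<rho>1 \<eta>1 \<rho>2 \<eta>2 \<delta>)"
proof -
  have S: "sublevel_set n t y \<rho>1 \<eta>1 \<rho>2 \<eta>2 \<delta> \<subseteq> {0<..<1}" by (auto simp: sublevel_set_def)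
  show ?thesis
    unfolding mu_low_def mu_up_def mem_interval_bounds_iff[OF S]
    by (rule ex_interval_around_iff[OF open_sublevel_set S emp_mean_bounds(1,2)[OF t y]])
qed

lemma segment_mem_unit_interval:
  fixes a c s :: real
  assumes "0 < a" "a < 1" "0 \<le> c" "c \<le> 1" "0 \<le> s" "s < 1"
  shows "0 < a + s * (c - a)" "a + s * (c - a) < 1"
proof -
  have "0 < (1 - s) * a" "0 \<le> s * c" "0 < (1 - s) * (1 - a)" "0 \<le> s * (1 - c)"
    using assms by auto
  thus "0 < a + s * (c - a)" "a + s * (c - a) < 1" by (auto simp: algebra_simps)
qed

text \<open>By \<open>mem_interval_iff\<close>, coverage says that \<open>h_breve\<close> is below
  \<open>1 / \<delta>\<close> along the segment from \<open>\<mu>\<close> to the empirical mean, and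
  at that mean when it is interior. Continuity reduces this to countably many measurable
  conditions.\<close>

lemma covered_event_measurable:
  assumes Y [measurable]: "\<And>i. i \<in> {1..t} \<Longrightarrow> Y i \<in> borel_measurable M"
    and Y01: "\<And>i \<omega>. i \<in> {1..t} \<Longrightarrow> \<omega> \<in> space M \<Longrightarrow> Y i \<omega> \<in> {0..1}"
    and t: "t \<ge> 1" and \<mu>: "0 < \<mu>" "\<mu> < 1"
  shows "{\<omega> \<in> space M. \<mu> \<in> {mu_low n t (\<lambda>i. Y i \<omega>) \<rho>1 \<eta>1 \<rho>2 \<eta>2 \<delta> <..<
    mu_up n t (\<lambda>i. Y i \<omega>) \<rho>1 \<eta>1 \<rho>2 \<eta>2 \<delta>}} \<in> sets M"
proof -
  define c where "c = (\<lambda>\<omega>. emp_mean t (\<lambda>i. Y i \<omega>))"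
  define h where "h = (\<lambda>m \<omega>. h_breve n t m (\<lambda>i. Y i \<omega>) \<rho>1 \<eta>1 \<rho>2 \<eta>2)"
  have [measurable]: "c \<in> borel_measurable M" unfolding c_def emp_mean_def by measurable
  have [measurable]: "(\<lambda>\<omega>. h (f \<omega>) \<omega>) \<in> borel_measurable M" if "f \<in> borel_measurable M" for f
    unfolding h_def using Y that by (rule measurable_h_breve)
  have "\<mu> \<in> {mu_low n t (\<lambda>i. Y i \<omega>) \<rho>1 \<eta>1 \<rho>2 \<eta>2 \<delta> <..< mu_up n t (\<lambda>i. Y i \<omega>) \<rho>1 \<eta>1 \<rho>2 \<eta>2 \<delta>} \<longleftrightarrow>
      (\<forall>j::nat. (SUP q\<in>{0..1 - 1 / real (Suc j)} \<inter> \<rat>. h (\<mu> + q * (c \<omega> - \<mu>)) \<omega>) < ennreal (1 / \<delta>))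
      \<and> (0 < c \<omega> \<and> c \<omega> < 1 \<longrightarrow> h (c \<omega>) \<omega> < ennreal (1 / \<delta>))" if \<omega>: "\<omega> \<in> space M" for \<omega>
  proof -
    have y: "Y i \<omega> \<in> {0..1}" if "i \<in> {1..t}" for i using Y01[OF that \<omega>] .
    have c: "0 \<le> c \<omega>" "c \<omega> \<le> 1" using emp_mean_bounds(1,2)[OF t, of "\<lambda>i. Y i \<omega>"] y by (auto simp: c_def)
    note seg = segment_mem_unit_interval[OF \<mu> c]
    have cont: "continuous_on {0..<1} (\<lambda>s. h (\<mu> + s * (c \<omega> - \<mu>)) \<omega>)"
      unfolding h_def using seg
      by (intro continuous_on_compose2[OF continuous_on_h_breve] continuous_intros) auto
    have "\<mu> \<in> {mu_low n t (\<lambda>i. Y i \<omega>) \<rho>1 \<eta>1 \<rho>2 \<eta>2 \<delta> <..< mu_up n t (\<lambda>i. Y i \<omega>) \<rho>1 \<eta>1 \<rho>2 \<eta>2 \<delta>} \<longleftrightarrow>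
        (\<forall>s\<in>{0..<1}. \<mu> + s * (c \<omega> - \<mu>) \<in> sublevel_set n t (\<lambda>i. Y i \<omega>) \<rho>1 \<eta>1 \<rho>2 \<eta>2 \<delta>)
        \<and> (c \<omega> \<in> {0<..<1} \<longrightarrow> c \<omega> \<in> sublevel_set n t (\<lambda>i. Y i \<omega>) \<rho>1 \<eta>1 \<rho>2 \<eta>2 \<delta>)"
      unfolding c_def by (rule mem_interval_iff[OF t y])
    also have "\<dots> \<longleftrightarrow>
        (\<forall>s\<in>{0..<1}. h (\<mu> + s * (c \<omega> - \<mu>)) \<omega> < ennreal (1 / \<delta>))
        \<and> (0 < c \<omega> \<and> c \<omega> < 1 \<longrightarrow> h (c \<omega>) \<omega> < ennreal (1 / \<delta>))"
      using seg by (auto simp: sublevel_set_def h_def)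
    finally show ?thesis unfolding all_less_iff_SUP_Rats_less[OF cont] .
  qed
  hence "{\<omega> \<in> space M. \<mu> \<in> {mu_low n t (\<lambda>i. Y i \<omega>) \<rho>1 \<eta>1 \<rho>2 \<eta>2 \<delta> <..< mu_up n t (\<lambda>i. Y i \<omega>) \<rho>1 \<eta>1 \<rho>2 \<eta>2 \<delta>}}
    = {\<omega> \<in> space M. (\<forall>j::nat. (SUP q\<in>{0..1 - 1 / real (Suc j)} \<inter> \<rat>. h (\<mu> + q * (c \<omega> - \<mu>)) \<omega>) < ennreal (1 / \<delta>))
      \<and> (0 < c \<omega> \<and> c \<omega> < 1 \<longrightarrow> h (c \<omega>) \<omega> < ennreal (1 / \<delta>))}" by blast
  also have "\<dots> \<in> sets M"
  proof -
    have [measurable]: "(\<lambda>\<omega>. SUP q\<in>{0..1 - 1 / real (Suc j)} \<inter> \<rat>. h (\<mu> + q * (c \<omega> - \<mu>)) \<omega>) \<in> borel_measurable M" for j :: nat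
      by (intro borel_measurable_SUP countable_Int2 countable_rat) measurable
    show ?thesis by measurable
  qed
  finally show ?thesis .
qed

section \<open>Martingales and coverage\<close>

text \<open>The supermartingale property is stated by integrals over events of \<open>F t\<close>,
  which makes sense for infinite values of \<open>W\<close>. Induction on \<open>T\<close> replaces
  a stopping time: \<open>U T\<close>, a crossing up to time \<open>T\<close>, contributes
  \<open>K\<close>, and its complement contributes \<open>W T\<close>.\<close>

lemma ville_inequality:
  fixes W :: "nat \<Rightarrow> 'a \<Rightarrow> ennreal" and F :: "nat \<Rightarrow> 'a measure"
  assumes sub: "\<And>t. subalgebra M (F t)" and mono: "\<And>t. sets (F t) \<subseteq> sets (F (Suc t))"
    and W: "\<And>t. W t \<in> borel_measurable (F t)"
    and super: "\<And>t A. A \<in> sets (F t) \<Longrightarrow> (\<integral>\<^sup>+\<omega>\<in>A. W (Suc t) \<omega> \<partial>M) \<le> (\<integral>\<^sup>+\<omega>\<in>A. W t \<omega> \<partial>M)"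
  shows "K * emeasure M {\<omega> \<in> space M. \<exists>t. K \<le> W t \<omega>} \<le> (\<integral>\<^sup>+\<omega>. W 0 \<omega> \<partial>M)"
proof -
  define U where "U = (\<lambda>T. {\<omega> \<in> space M. \<exists>t\<le>T. K \<le> W t \<omega>})"
  have sp: "space (F t) = space M" for t using sub[of t] by (simp add: subalgebra_def)
  have FM: "sets (F t) \<subseteq> sets M" for t using sub[of t] by (simp add: subalgebra_def)
  have [measurable]: "W t \<in> borel_measurable M" for t
    by (rule measurable_from_subalg[OF sub W])
  have Fle: "sets (F t) \<subseteq> sets (F T)" if "t \<le> T" for t T
    using mono that by (rule lift_Suc_mono_le)
  have UF: "U T \<in> sets (F T)" for T
  proof -
    have [measurable]: "W t \<in> borel_measurable (F T)" if "t \<le> T" for t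
      by (rule measurable_from_subalg[OF _ W[of t]]) (use Fle[OF that] sp in \<open>simp add: subalgebra_def\<close>)
    have "{\<omega> \<in> space (F T). \<exists>t\<in>{..T}. K \<le> W t \<omega>} \<in> sets (F T)" by measurable
    also have "{\<omega> \<in> space (F T). \<exists>t\<in>{..T}. K \<le> W t \<omega>} = U T" by (auto simp: U_def sp)
    finally show ?thesis .
  qed
  have UM [measurable]: "U T \<in> sets M" for T using UF FM by blast
  have "K * emeasure M (U T) + (\<integral>\<^sup>+\<omega>\<in>space M - U T. W T \<omega> \<partial>M) \<le> (\<integral>\<^sup>+\<omega>. W 0 \<omega> \<partial>M)" for T
  proof (induction T)
    case 0
    have "K * emeasure M (U 0) + (\<integral>\<^sup>+\<omega>\<in>space M - U 0. W 0 \<omega> \<partial>M)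
        = (\<integral>\<^sup>+\<omega>. K * indicator (U 0) \<omega> + W 0 \<omega> * indicator (space M - U 0) \<omega> \<partial>M)"
      by (simp add: nn_integral_add nn_integral_cmult_indicator)
    also have "\<dots> \<le> (\<integral>\<^sup>+\<omega>. W 0 \<omega> \<partial>M)"
      by (intro nn_integral_mono) (auto simp: U_def split: split_indicator)
    finally show ?case .
  next
    case (Suc T)
    have "K * emeasure M (U (Suc T)) + (\<integral>\<^sup>+\<omega>\<in>space M - U (Suc T). W (Suc T) \<omega> \<partial>M)
        = (\<integral>\<^sup>+\<omega>. K * indicator (U (Suc T)) \<omega> + W (Suc T) \<omega> * indicator (space M - U (Suc T)) \<omega> \<partial>M)"
      by (simp add: nn_integral_add nn_integral_cmult_indicator)
    \<comment> \<open>On the paths that first cross at time \<open>Suc T\<close>, the value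
      \<open>K\<close> is at most \<open>W (Suc T)\<close>.\<close>
    also have "\<dots> \<le> (\<integral>\<^sup>+\<omega>. K * indicator (U T) \<omega> + W (Suc T) \<omega> * indicator (space M - U T) \<omega> \<partial>M)"
      by (intro nn_integral_mono) (auto simp: U_def le_Suc_eq split: split_indicator)
    also have "\<dots> = K * emeasure M (U T) + (\<integral>\<^sup>+\<omega>\<in>space M - U T. W (Suc T) \<omega> \<partial>M)"
      by (simp add: nn_integral_add nn_integral_cmult_indicator)
    \<comment> \<open>The complement of \<open>U T\<close> is an event of \<open>F T\<close>, so the
      supermartingale inequality applies there.\<close>
    also have "\<dots> \<le> K * emeasure M (U T) + (\<integral>\<^sup>+\<omega>\<in>space M - U T. W T \<omega> \<partial>M)"
      using sets.Diff[OF sets.top UF, of T] by (intro add_left_mono super) (simp add: sp)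
    finally show ?case using Suc.IH by (rule order.trans)
  qed
  hence bound: "K * emeasure M (U T) \<le> (\<integral>\<^sup>+\<omega>. W 0 \<omega> \<partial>M)" for T
    using order.trans[OF add_increasing2[OF zero_le order.refl]] by blast
  have "incseq U" unfolding incseq_def U_def by (auto intro: order.trans)
  hence "emeasure M (\<Union>T. U T) = (SUP T. emeasure M (U T))"
    by (intro SUP_emeasure_incseq[symmetric]) auto
  moreover have "(\<Union>T. U T) = {\<omega> \<in> space M. \<exists>t. K \<le> W t \<omega>}" by (auto simp: U_def)
  ultimately have "K * emeasure M {\<omega> \<in> space M. \<exists>t. K \<le> W t \<omega>} = (SUP T. K * emeasure M (U T))"
    by (simp add: SUP_mult_left_ennreal)
  also have "\<dots> \<le> (\<integral>\<^sup>+\<omega>. W 0 \<omega> \<partial>M)" by (intro SUP_least bound)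
  finally show ?thesis .
qed

section \<open>Martingale property of wealth and of its mixtures\<close>

lemma wealth_Suc: "wealth (Suc t) x y m = wealth t x y m * (x + (1 - x) * (y (Suc t) / m))"
  by (simp add: wealth_def)

lemma measurable_wealth_pair:
  assumes [measurable]: "\<And>i. i \<in> {1..t} \<Longrightarrow> X i \<in> borel_measurable M"
  shows "(\<lambda>(\<omega>, x). wealth t x (\<lambda>i. X i \<omega>) m) \<in> borel_measurable (M \<Otimes>\<^sub>M borel)"
  unfolding wealth_def by measurable

lemma measurable_mixture:
  assumes [measurable]: "\<And>i. i \<in> {1..t} \<Longrightarrow> X i \<in> borel_measurable M"
  shows "(\<lambda>\<omega>. mixture n t \<rho> \<eta> (\<lambda>i. X i \<omega>) m) \<in> borel_measurable M"
proof -
  have "(\<lambda>(\<omega>, x). ennreal (wealth t x (\<lambda>i. X i \<omega>) m * phi n \<rho> \<eta> x) * indicator {0<..<1} x)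
    \<in> borel_measurable (M \<Otimes>\<^sub>M lborel)"
    unfolding wealth_def by measurable
  thus ?thesis unfolding mixture_def by (rule lborel.borel_measurable_nn_integral)
qed

text \<open>The next factor is affine in \<open>X (Suc t)\<close>, with conditional mean
  \<open>x + (1 - x) = 1\<close>. The hypothesis on the conditional mean is phrased with bounded
  nonnegative test functions, and the capital restricted to \<open>A\<close> is one of them.\<close>

lemma (in prob_space) wealth_martingale:
  assumes F: "subalgebra M F" and X: "\<And>i. i \<in> {1..t} \<Longrightarrow> X i \<in> borel_measurable F"
    and X' [measurable]: "X (Suc t) \<in> borel_measurable M"
    and X01: "\<And>i \<omega>. i \<in> {1..Suc t} \<Longrightarrow> \<omega> \<in> space M \<Longrightarrow> X i \<omega> \<in> {0..1}"
    and cond: "\<And>f. f \<in> borel_measurable F \<Longrightarrow> \<exists>B. \<forall>\<omega>\<in>space M. f \<omega> \<in> {0..B} \<Longrightarrow>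
      expectation (\<lambda>\<omega>. f \<omega> * X (Suc t) \<omega>) = m * expectation f"
    and m: "0 < m" and A: "A \<in> sets F" and x: "0 < x" "x < 1"
  shows "(\<integral>\<^sup>+\<omega>\<in>A. ennreal (wealth (Suc t) x (\<lambda>i. X i \<omega>) m) \<partial>M)
    = (\<integral>\<^sup>+\<omega>\<in>A. ennreal (wealth t x (\<lambda>i. X i \<omega>) m) \<partial>M)"
proof -
  define f where "f = (\<lambda>\<omega>. wealth t x (\<lambda>i. X i \<omega>) m * indicator A \<omega>)"
  \<comment> \<open>Each factor is at most its value at \<open>X i \<omega> = 1\<close>.\<close>
  define B where "B = (x + (1 - x) * (1 / m)) ^ t"
  define Z where "Z = (\<lambda>\<omega>. x + (1 - x) * (X (Suc t) \<omega> / m))"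
  have fF: "f \<in> borel_measurable F" unfolding f_def wealth_def using X A by measurable
  have [measurable]: "f \<in> borel_measurable M" by (rule measurable_from_subalg[OF F fF])
  have f: "0 \<le> f \<omega>" "f \<omega> \<le> B" if "\<omega> \<in> space M" for \<omega>
  proof -
    have Xi: "0 \<le> X i \<omega>" "X i \<omega> \<le> 1" if "i \<in> {1..t}" for i using X01[of i \<omega>] that \<open>\<omega> \<in> space M\<close> by auto
    have "0 \<le> wealth t x (\<lambda>i. X i \<omega>) m" using x m Xi by (intro wealth_nonneg) auto
    moreover have "wealth t x (\<lambda>i. X i \<omega>) m \<le> (\<Prod>i = 1..t. x + (1 - x) * (1 / m))"
      unfolding wealth_def using x m Xi
      by (intro prod_mono conjI add_left_mono mult_left_mono divide_right_mono add_nonneg_nonneg mult_nonneg_nonneg) auto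
    ultimately show "0 \<le> f \<omega>" "f \<omega> \<le> B" by (auto simp: f_def B_def split: split_indicator)
  qed
  have X'01: "0 \<le> X (Suc t) \<omega>" "X (Suc t) \<omega> \<le> 1" if "\<omega> \<in> space M" for \<omega> using X01[of "Suc t" \<omega>] that by auto
  have int: "integrable M f" using f by (intro integrable_const_bound[of _ B]) auto
  have intX: "integrable M (\<lambda>\<omega>. f \<omega> * X (Suc t) \<omega>)"
    using f X'01 by (intro integrable_const_bound[of _ B] AE_I2)
      (auto simp: abs_mult intro: order.trans[OF mult_left_le])
  have eq: "f \<omega> * Z \<omega> = x * f \<omega> + (1 - x) / m * (f \<omega> * X (Suc t) \<omega>)" for \<omega>
    by (simp add: Z_def algebra_simps)
  have intZ: "integrable M (\<lambda>\<omega>. f \<omega> * Z \<omega>)" unfolding eq using int intX by simp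
  have Z: "0 \<le> Z \<omega>" if "\<omega> \<in> space M" for \<omega> using X'01[OF that] x m by (simp add: Z_def)
  have "(\<integral>\<^sup>+\<omega>\<in>A. ennreal (wealth (Suc t) x (\<lambda>i. X i \<omega>) m) \<partial>M) = (\<integral>\<^sup>+\<omega>. ennreal (f \<omega> * Z \<omega>) \<partial>M)"
    by (intro nn_integral_cong) (auto simp: f_def Z_def wealth_Suc split: split_indicator)
  also have "\<dots> = ennreal (expectation (\<lambda>\<omega>. f \<omega> * Z \<omega>))"
    using f Z by (intro nn_integral_eq_integral AE_I2 intZ) auto
  also have "expectation (\<lambda>\<omega>. f \<omega> * Z \<omega>) = x * expectation f + (1 - x) / m * (m * expectation f)"
  proof -
    have "\<exists>B. \<forall>\<omega>\<in>space M. f \<omega> \<in> {0..B}" using f by auto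
    thus ?thesis using int intX cond[OF fF] unfolding eq by simp
  qed
  also have "\<dots> = expectation f" using m by (simp add: field_simps)
  also have "ennreal (expectation f) = (\<integral>\<^sup>+\<omega>. ennreal (f \<omega>) \<partial>M)"
    using f int by (intro nn_integral_eq_integral[symmetric] AE_I2) auto
  also have "\<dots> = (\<integral>\<^sup>+\<omega>\<in>A. ennreal (wealth t x (\<lambda>i. X i \<omega>) m) \<partial>M)"
    by (intro nn_integral_cong) (auto simp: f_def split: split_indicator)
  finally show ?thesis .
qed

text \<open>For each fixed \<open>x\<close> the capital is a martingale. Nonnegativity allows the
  integrals over \<open>\<omega>\<close> and \<open>x\<close> to be exchanged, even if the prior
  density is not integrable.\<close>

lemma (in prob_space) mixture_martingale:
  assumes F: "subalgebra M F" and X: "\<And>i. i \<in> {1..t} \<Longrightarrow> X i \<in> borel_measurable F"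
    and X': "X (Suc t) \<in> borel_measurable M"
    and X01: "\<And>i \<omega>. i \<in> {1..Suc t} \<Longrightarrow> \<omega> \<in> space M \<Longrightarrow> X i \<omega> \<in> {0..1}"
    and cond: "\<And>f. f \<in> borel_measurable F \<Longrightarrow> \<exists>B. \<forall>\<omega>\<in>space M. f \<omega> \<in> {0..B} \<Longrightarrow>
      expectation (\<lambda>\<omega>. f \<omega> * X (Suc t) \<omega>) = m * expectation f"
    and m: "0 < m" and A: "A \<in> sets F"
  shows "(\<integral>\<^sup>+\<omega>\<in>A. mixture n (Suc t) \<rho> \<eta> (\<lambda>i. X i \<omega>) m \<partial>M)
    = (\<integral>\<^sup>+\<omega>\<in>A. mixture n t \<rho> \<eta> (\<lambda>i. X i \<omega>) m \<partial>M)"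
proof -
  interpret pair_sigma_finite M lborel ..
  have [measurable]: "A \<in> sets M" using A F by (auto simp: subalgebra_def)
  have XM: "X i \<in> borel_measurable M" if "i \<in> {1..Suc t}" for i
  proof (cases "i = Suc t")
    case True
    thus ?thesis using X' by simp
  next
    case False
    thus ?thesis using that by (intro measurable_from_subalg[OF F X]) simp
  qed
  have fubini: "(\<integral>\<^sup>+\<omega>\<in>A. mixture n s \<rho> \<eta> (\<lambda>i. X i \<omega>) m \<partial>M)
      = (\<integral>\<^sup>+x\<in>{0<..<1}. ennreal (phi n \<rho> \<eta> x) * (\<integral>\<^sup>+\<omega>\<in>A. ennreal (wealth s x (\<lambda>i. X i \<omega>) m) \<partial>M) \<partial>lborel)"
    if s: "s \<le> Suc t" for s
  proof -
    have Xs [measurable]: "X i \<in> borel_measurable M" if "i \<in> {1..s}" for i using XM that s by auto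
    have [measurable]: "(\<lambda>(\<omega>, x). wealth s x (\<lambda>i. X i \<omega>) m) \<in> borel_measurable (M \<Otimes>\<^sub>M borel)"
      by (rule measurable_wealth_pair) measurable
    let ?I = "indicator {0<..<1} :: real \<Rightarrow> ennreal"
    let ?h = "\<lambda>\<omega> x. ennreal (phi n \<rho> \<eta> x) * ennreal (wealth s x (\<lambda>i. X i \<omega>) m) * ?I x * indicator A \<omega>"
    have "(\<integral>\<^sup>+\<omega>\<in>A. mixture n s \<rho> \<eta> (\<lambda>i. X i \<omega>) m \<partial>M) = (\<integral>\<^sup>+\<omega>. (\<integral>\<^sup>+x. ?h \<omega> x \<partial>lborel) \<partial>M)"
      unfolding mixture_def using phi_pos[of n \<rho> \<eta>]
      by (intro nn_integral_cong) (auto simp: ennreal_mult' less_imp_le mult.commute split: split_indicator)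
    also have "\<dots> = (\<integral>\<^sup>+x. (\<integral>\<^sup>+\<omega>. ?h \<omega> x \<partial>M) \<partial>lborel)"
      by (rule Fubini'[symmetric]) measurable
    also have "\<dots> = (\<integral>\<^sup>+x\<in>{0<..<1}. ennreal (phi n \<rho> \<eta> x) * (\<integral>\<^sup>+\<omega>\<in>A. ennreal (wealth s x (\<lambda>i. X i \<omega>) m) \<partial>M) \<partial>lborel)"
      by (intro nn_integral_cong)
        (auto simp: nn_integral_cmult[symmetric] mult.assoc wealth_def split: split_indicator)
    finally show ?thesis .
  qed
  show ?thesis unfolding fubini[OF order.refl] fubini[OF le_SucI[OF order.refl]]
    using wealth_martingale[where X = X and F = F and m = m, OF assms]
    by (intro nn_integral_cong) (auto split: split_indicator)
qed

section \<open>The filtration of the sample, and the crossing bound at the true mean\<close>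

lemma past_subalgebra:
  assumes "\<And>t. t \<ge> 1 \<Longrightarrow> Y t \<in> borel_measurable M"
  shows "subalgebra M (past M Y t)"
proof -
  have "(\<lambda>\<omega>. \<lambda>i\<in>{1..<t}. Y i \<omega>) \<in> measurable M (Pi\<^sub>M {1..<t} (\<lambda>_. borel))"
    using assms by (intro measurable_restrict) auto
  thus ?thesis unfolding subalgebra_def past_def by (auto dest: sets_image_in_sets[OF refl])
qed

lemma measurable_past:
  assumes "i \<in> {1..<t}"
  shows "Y i \<in> borel_measurable (past M Y t)"
proof -
  have "(\<lambda>\<omega>. \<lambda>i\<in>{1..<t}. Y i \<omega>) \<in> measurable (past M Y t) (Pi\<^sub>M {1..<t} (\<lambda>_. borel))"
    unfolding past_def by (rule measurable_vimage_algebra1) (auto simp: space_PiM)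
  from measurable_compose[OF this measurable_component_singleton[OF assms]]
  show ?thesis using assms by simp
qed

lemma past_mono: "sets (past M Y t) \<subseteq> sets (past M Y (Suc t))"
proof -
  have "(\<lambda>\<omega>. \<lambda>i\<in>{1..<t}. Y i \<omega>) \<in> measurable (past M Y (Suc t)) (Pi\<^sub>M {1..<t} (\<lambda>_. borel))"
    by (intro measurable_restrict measurable_past) auto
  from sets_image_in_sets[OF _ this, of "space M"] show ?thesis
    unfolding past_def by simp
qed

lemma mixture_0: "mixture n 0 \<rho> \<eta> y m = Zn n \<rho> \<eta>"
  by (simp add: mixture_def Zn_def wealth_def)

lemma measurable_game_value:
  assumes [measurable]: "\<And>i. i \<in> {1..t} \<Longrightarrow> Y i \<in> borel_measurable M"
  shows "(\<lambda>\<omega>. game_value n t (\<lambda>i. Y i \<omega>) \<rho>1 \<eta>1 \<rho>2 \<eta>2 m) \<in> borel_measurable M"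
proof -
  have [measurable]: "(\<lambda>\<omega>. mixture n t \<rho>1 \<eta>1 (\<lambda>i. Y i \<omega>) m) \<in> borel_measurable M"
    "(\<lambda>\<omega>. mixture n t \<rho>2 \<eta>2 (\<lambda>i. 1 - Y i \<omega>) (1 - m)) \<in> borel_measurable M"
    by (rule measurable_mixture; measurable)+
  show ?thesis unfolding game_value_def by measurable
qed

text \<open>At the true mean both mixtures are martingales, hence so is their weighted sum, and
  \<open>ville_inequality\<close> applies to it. At time \<open>0\<close> the mixtures reduce to
  \<open>Zn\<close>.\<close>

lemma (in prob_space) game_value_crossing:
  assumes Y [measurable]: "\<And>t. t \<ge> 1 \<Longrightarrow> Y t \<in> borel_measurable M"
    and Y01: "\<And>t \<omega>. t \<ge> 1 \<Longrightarrow> \<omega> \<in> space M \<Longrightarrow> Y t \<omega> \<in> {0..1}"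
    and \<mu>: "0 < \<mu>" "\<mu> < 1"
    and cond: "\<And>t. t \<ge> 1 \<Longrightarrow> AE \<omega> in M. real_cond_exp M (past M Y t) (Y t) \<omega> = \<mu>"
  shows "K * emeasure M {\<omega> \<in> space M. \<exists>t. K \<le> game_value n t (\<lambda>i. Y i \<omega>) \<rho>1 \<eta>1 \<rho>2 \<eta>2 \<mu>}
    \<le> ennreal (1 - \<mu>) * Zn n \<rho>1 \<eta>1 + ennreal \<mu> * Zn n \<rho>2 \<eta>2"
proof -
  \<comment> \<open>\<open>past M Y (Suc t)\<close> is generated by the first \<open>t\<close>
    observations; with this shift \<open>W t\<close> is adapted, starting from the trivial
    \<open>F 0\<close>.\<close>
  define F where "F = (\<lambda>t. past M Y (Suc t))"
  define W where "W = (\<lambda>t \<omega>. game_value n t (\<lambda>i. Y i \<omega>) \<rho>1 \<eta>1 \<rho>2 \<eta>2 \<mu>)"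
  have sub: "subalgebra M (F t)" for t unfolding F_def using Y by (rule past_subalgebra)
  have YF: "Y i \<in> borel_measurable (F t)" if "i \<in> {1..t}" for i t
    unfolding F_def using that by (intro measurable_past) auto
  \<comment> \<open>The almost sure equation for the conditional expectation is turned into the
    test-function form used by \<open>mixture_martingale\<close>. The second equation is for the
    reflected sample.\<close>
  have cY: "expectation (\<lambda>\<omega>. f \<omega> * Y (Suc t) \<omega>) = \<mu> * expectation f"
    "expectation (\<lambda>\<omega>. f \<omega> * (1 - Y (Suc t) \<omega>)) = (1 - \<mu>) * expectation f"
    if f: "f \<in> borel_measurable (F t)" "\<exists>B. \<forall>\<omega>\<in>space M. f \<omega> \<in> {0..B}" for f t
  proof -
    obtain B where B: "\<And>\<omega>. \<omega> \<in> space M \<Longrightarrow> f \<omega> \<in> {0..B}" using f(2) by blast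
    interpret sigma_finite_subalgebra M "F t"
      using sub by (intro finite_measure_subalgebra_is_sigma_finite)
        (simp add: finite_measure_subalgebra_def finite_measure_subalgebra_axioms_def finite_measure_axioms)
    have fM [measurable]: "f \<in> borel_measurable M" by (rule measurable_from_subalg[OF sub f(1)])
    have Yt: "0 \<le> Y (Suc t) \<omega>" "Y (Suc t) \<omega> \<le> 1" "0 \<le> f \<omega>" "f \<omega> \<le> B" if "\<omega> \<in> space M" for \<omega>
      using Y01[of "Suc t" \<omega>] B[of \<omega>] that by auto
    have int: "integrable M f" using Yt by (intro integrable_const_bound[of _ B] AE_I2) auto
    have intY: "integrable M (\<lambda>\<omega>. f \<omega> * Y (Suc t) \<omega>)"
      using Yt by (intro integrable_const_bound[of _ B] AE_I2)
        (auto simp: abs_mult intro: order.trans[OF mult_left_le])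
    have "expectation (\<lambda>\<omega>. f \<omega> * Y (Suc t) \<omega>)
        = expectation (\<lambda>\<omega>. f \<omega> * real_cond_exp M (F t) (Y (Suc t)) \<omega>)"
      using real_cond_exp_intg(2)[OF intY f(1)] by simp
    also have "\<dots> = expectation (\<lambda>\<omega>. f \<omega> * \<mu>)"
      using cond[of "Suc t"] measurable_from_subalg[OF sub borel_measurable_cond_exp]
      by (intro integral_cong_AE) (auto simp: F_def)
    finally show *: "expectation (\<lambda>\<omega>. f \<omega> * Y (Suc t) \<omega>) = \<mu> * expectation f" by simp
    show "expectation (\<lambda>\<omega>. f \<omega> * (1 - Y (Suc t) \<omega>)) = (1 - \<mu>) * expectation f"
      using * int intY by (simp add: right_diff_distrib left_diff_distrib)
  qed
  have [measurable]: "(\<lambda>\<omega>. mixture n t \<rho>1 \<eta>1 (\<lambda>i. Y i \<omega>) \<mu>) \<in> borel_measurable M"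
    "(\<lambda>\<omega>. mixture n t \<rho>2 \<eta>2 (\<lambda>i. 1 - Y i \<omega>) (1 - \<mu>)) \<in> borel_measurable M" for t
    using Y by (auto intro!: measurable_mixture borel_measurable_diff)
  have WF: "W t \<in> borel_measurable (F t)" for t
    unfolding W_def using YF by (rule measurable_game_value)
  have super: "(\<integral>\<^sup>+\<omega>\<in>A. W (Suc t) \<omega> \<partial>M) \<le> (\<integral>\<^sup>+\<omega>\<in>A. W t \<omega> \<partial>M)" if A: "A \<in> sets (F t)" for t A
  proof -
    have [measurable]: "A \<in> sets M" using A sub[of t] by (auto simp: subalgebra_def)
    have split: "(\<integral>\<^sup>+\<omega>\<in>A. W s \<omega> \<partial>M)
      = ennreal (1 - \<mu>) * (\<integral>\<^sup>+\<omega>\<in>A. mixture n s \<rho>1 \<eta>1 (\<lambda>i. Y i \<omega>) \<mu> \<partial>M)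
        + ennreal \<mu> * (\<integral>\<^sup>+\<omega>\<in>A. mixture n s \<rho>2 \<eta>2 (\<lambda>i. 1 - Y i \<omega>) (1 - \<mu>) \<partial>M)" for s
      by (simp add: W_def game_value_def distrib_right mult.assoc nn_integral_add nn_integral_cmult)
    have m1: "(\<integral>\<^sup>+\<omega>\<in>A. mixture n (Suc t) \<rho>1 \<eta>1 (\<lambda>i. Y i \<omega>) \<mu> \<partial>M)
        = (\<integral>\<^sup>+\<omega>\<in>A. mixture n t \<rho>1 \<eta>1 (\<lambda>i. Y i \<omega>) \<mu> \<partial>M)"
      by (rule mixture_martingale[where X = Y and F = "F t"])
        (use sub YF Y Y01 cY(1) \<mu> A in auto)
    have m2: "(\<integral>\<^sup>+\<omega>\<in>A. mixture n (Suc t) \<rho>2 \<eta>2 (\<lambda>i. 1 - Y i \<omega>) (1 - \<mu>) \<partial>M)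
        = (\<integral>\<^sup>+\<omega>\<in>A. mixture n t \<rho>2 \<eta>2 (\<lambda>i. 1 - Y i \<omega>) (1 - \<mu>) \<partial>M)"
      by (rule mixture_martingale[where X = "\<lambda>i \<omega>. 1 - Y i \<omega>" and F = "F t"])
        (use sub YF Y Y01 cY(2) \<mu> A in auto)
    show ?thesis unfolding split m1 m2 by simp
  qed
  have "sets (F t) \<subseteq> sets (F (Suc t))" for t unfolding F_def by (rule past_mono)
  from ville_inequality[of M F W K, OF sub this WF super]
  have "K * emeasure M {\<omega> \<in> space M. \<exists>t. K \<le> W t \<omega>} \<le> (\<integral>\<^sup>+\<omega>. W 0 \<omega> \<partial>M)" by simp
  also have "(\<integral>\<^sup>+\<omega>. W 0 \<omega> \<partial>M) = ennreal (1 - \<mu>) * Zn n \<rho>1 \<eta>1 + ennreal \<mu> * Zn n \<rho>2 \<eta>2"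
    by (simp add: W_def game_value_def mixture_0 emeasure_space_1)
  finally show ?thesis by (simp add: W_def)
qed

section \<open>Coverage uniformly in time\<close>

theorem corollary19:
  fixes M :: "'a measure" and Y :: "nat \<Rightarrow> 'a \<Rightarrow> real" and \<mu> :: real
    and n :: nat and \<rho>1 \<rho>2 :: "nat \<Rightarrow> real" and \<eta>1 \<eta>2 \<delta> :: real
  assumes "prob_space M"
    and "\<And>t. t \<ge> 1 \<Longrightarrow> Y t \<in> borel_measurable M"
    and "\<And>t \<omega>. t \<ge> 1 \<Longrightarrow> \<omega> \<in> space M \<Longrightarrow> Y t \<omega> \<in> {0..1}"
    and "\<mu> \<in> {0<..<1}"
    and "\<And>t. t \<ge> 1 \<Longrightarrow> AE \<omega> in M. real_cond_exp M (past M Y t) (Y t) \<omega> = \<mu>"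
    and "n \<ge> 1"
    and "\<delta> \<in> {0<..1}"
  defines "miss \<equiv> {\<omega> \<in> space M. \<exists>t\<ge>1.
      \<mu> \<notin> {mu_low n t (\<lambda>i. Y i \<omega>) \<rho>1 \<eta>1 \<rho>2 \<eta>2 \<delta> <..< mu_up n t (\<lambda>i. Y i \<omega>) \<rho>1 \<eta>1 \<rho>2 \<eta>2 \<delta>}}"
  shows "miss \<in> sets M \<and> measure M miss \<le> \<delta>"
proof
  interpret prob_space M by fact
  have \<mu>: "0 < \<mu>" "\<mu> < 1" using assms(4) by auto
  have \<delta>: "0 < \<delta>" "\<delta> \<le> 1" using assms(7) by auto
  define cov where "cov = (\<lambda>t. {\<omega> \<in> space M. \<mu> \<in> {mu_low n t (\<lambda>i. Y i \<omega>) \<rho>1 \<eta>1 \<rho>2 \<eta>2 \<delta> <..<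
    mu_up n t (\<lambda>i. Y i \<omega>) \<rho>1 \<eta>1 \<rho>2 \<eta>2 \<delta>}})"
  have "cov t \<in> sets M" if "t \<ge> 1" for t
    unfolding cov_def using assms(2,3) that \<mu> by (intro covered_event_measurable) auto
  moreover have "miss = (\<Union>t\<in>{1..}. space M - cov t)"
    unfolding miss_def cov_def by blast
  ultimately show miss: "miss \<in> sets M" by auto
  show "measure M miss \<le> \<delta>"
  \<comment> \<open>For \<open>\<delta> = 1\<close> the bound is trivial; the segment argument needs
    \<open>1 / \<delta> > 1\<close>.\<close>
  proof (cases "\<delta> = 1")
    case True
    thus ?thesis by simp
  next
    case False
    hence \<delta>1: "\<delta> < 1" using \<delta> by simp
    show ?thesis
    proof (cases "Zn n \<rho>1 \<eta>1 < \<infinity> \<and> Zn n \<rho>2 \<eta>2 < \<infinity>")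
      case False
      hence inf: "Zn n \<rho>1 \<eta>1 = \<infinity> \<or> Zn n \<rho>2 \<eta>2 = \<infinity>" by (auto simp: less_top[symmetric])
      \<comment> \<open>With an improper prior \<open>h_breve\<close> is \<open>0\<close> on the
        open unit interval, so the sublevel set is all of it and \<open>\<mu>\<close> is always
        covered.\<close>
      have S: "sublevel_set n t y \<rho>1 \<eta>1 \<rho>2 \<eta>2 \<delta> = {0<..<1}" for t y
        using h_breve_eq_0[OF inf] \<delta> by (auto simp: sublevel_set_def)
      have "\<omega> \<in> cov t" if t: "t \<ge> 1" and \<omega>: "\<omega> \<in> space M" for t \<omega>
      proof -
        have y: "\<And>i. i \<in> {1..t} \<Longrightarrow> Y i \<omega> \<in> {0..1}" using assms(3) \<omega> by auto
        note c = emp_mean_bounds(1,2)[of t "\<lambda>i. Y i \<omega>", OF t y]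
        show ?thesis
          using mem_interval_iff[of t "\<lambda>i. Y i \<omega>" \<mu> n \<rho>1 \<eta>1 \<rho>2 \<eta>2 \<delta>, OF t y]
            segment_mem_unit_interval[OF \<mu> c] \<omega>
          unfolding S cov_def by simp
      qed
      hence "miss = {}" unfolding \<open>miss = _\<close> by auto
      thus ?thesis using \<delta> by simp
    next
      case True
      define V where "V = ennreal (1 - \<mu>) * Zn n \<rho>1 \<eta>1 + ennreal \<mu> * Zn n \<rho>2 \<eta>2"
      \<comment> \<open>The threshold \<open>1 / \<delta>\<close> is multiplied by the initial value
        \<open>V\<close>, since \<open>game_value\<close> is not normalized.\<close>
      define K where "K = ennreal (1 / \<delta>) * V"
      define E where "E = {\<omega> \<in> space M. \<exists>t. K \<le> game_value n t (\<lambda>i. Y i \<omega>) \<rho>1 \<eta>1 \<rho>2 \<eta>2 \<mu>}"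
      have V: "V \<noteq> 0" "V < top" using denominator_bounds[of n \<rho>1 \<eta>1 \<rho>2 \<eta>2 \<mu>] True \<mu> by (auto simp: V_def)
      \<comment> \<open>If \<open>game_value\<close> never reaches \<open>K\<close> at
        \<open>\<mu>\<close>, then at every time the segment from \<open>\<mu>\<close> to the
        empirical mean lies in the sublevel set, up to an end at \<open>0\<close> or
        \<open>1\<close>, so \<open>\<mu>\<close> is covered.\<close>
      have "miss \<subseteq> E"
      proof
        fix \<omega> assume "\<omega> \<in> miss"
        then obtain t where t: "t \<ge> 1" and \<omega>: "\<omega> \<in> space M" and nin: "\<mu> \<notin>
            {mu_low n t (\<lambda>i. Y i \<omega>) \<rho>1 \<eta>1 \<rho>2 \<eta>2 \<delta> <..< mu_up n t (\<lambda>i. Y i \<omega>) \<rho>1 \<eta>1 \<rho>2 \<eta>2 \<delta>}"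
          by (auto simp: miss_def)
        show "\<omega> \<in> E"
        proof (rule ccontr)
          assume "\<omega> \<notin> E"
          hence less: "game_value n t (\<lambda>i. Y i \<omega>) \<rho>1 \<eta>1 \<rho>2 \<eta>2 \<mu> < K"
            using \<omega> by (auto simp: E_def not_le)
          have y: "\<And>i. i \<in> {1..t} \<Longrightarrow> Y i \<omega> \<in> {0..1}" using assms(3) \<omega> by auto
          define c where "c = emp_mean t (\<lambda>i. Y i \<omega>)"
          have c: "0 \<le> c" "c \<le> 1"
            using emp_mean_bounds(1,2)[of t "\<lambda>i. Y i \<omega>", OF t y] by (auto simp: c_def)
          have "\<mu> + s * (c - \<mu>) \<in> sublevel_set n t (\<lambda>i. Y i \<omega>) \<rho>1 \<eta>1 \<rho>2 \<eta>2 \<delta>"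
            if "0 \<le> s" "s \<le> 1" "0 < \<mu> + s * (c - \<mu>)" "\<mu> + s * (c - \<mu>) < 1" for s
            using segment_subset_sublevel_set[of n t "\<lambda>i. Y i \<omega>", OF assms(6) t y] \<delta> \<delta>1 True \<mu> less that
            by (simp add: c_def K_def V_def)
          note seg = this
          have "\<mu> + s * (c - \<mu>) \<in> sublevel_set n t (\<lambda>i. Y i \<omega>) \<rho>1 \<eta>1 \<rho>2 \<eta>2 \<delta>" if "s \<in> {0..<1}" for s
          proof (rule seg)
            show "0 < \<mu> + s * (c - \<mu>)" "\<mu> + s * (c - \<mu>) < 1"
              using segment_mem_unit_interval[OF \<mu> c] that by auto
          qed (use that in auto)
          moreover have "c \<in> sublevel_set n t (\<lambda>i. Y i \<omega>) \<rho>1 \<eta>1 \<rho>2 \<eta>2 \<delta>" if "c \<in> {0<..<1}"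
            using seg[of 1] that by simp
          ultimately show False
            using nin mem_interval_iff[of t "\<lambda>i. Y i \<omega>" \<mu> n \<rho>1 \<eta>1 \<rho>2 \<eta>2 \<delta>, OF t y]
            unfolding c_def by blast
        qed
      qed
      have "(\<lambda>\<omega>. game_value n t (\<lambda>i. Y i \<omega>) \<rho>1 \<eta>1 \<rho>2 \<eta>2 \<mu>) \<in> borel_measurable M" for t
        using assms(2) by (intro measurable_game_value) auto
      hence E: "E \<in> sets M" unfolding E_def by measurable
      have "K * emeasure M E \<le> V"
        unfolding E_def V_def using assms(2,3,5) \<mu> by (intro game_value_crossing) auto
      hence "ennreal (1 / \<delta>) * emeasure M E * V \<le> 1 * V" by (simp add: K_def mult_ac)
      \<comment> \<open>\<open>V\<close> is positive and finite, so it can be cancelled.\<close>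
      hence "ennreal (1 / \<delta>) * emeasure M E \<le> 1"
        using V ennreal_mult_strict_right_mono[of 1 _ V] by (meson leD leI zero_less_iff_neq_zero)
      hence "measure M E \<le> \<delta>" using \<delta>
        by (simp add: emeasure_eq_measure field_simps flip: ennreal_mult ennreal_1)
      moreover have "measure M miss \<le> measure M E" by (intro finite_measure_mono \<open>miss \<subseteq> E\<close> E)
      ultimately show ?thesis by linarith
    qed
  qed
qed

end
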